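(* Let $p\ge 2$ be an integer and let $\sigma(x,y,z)$ and $\pi(x,y,z)$ be $L_p^{min}$-formulas that are approximations to the sum and product. Then the coarse interpretation $\mathfrak{C}=\mathfrak{C}_{\sigma,\pi}$ based on $\sigma$ and $\pi$ is decidable; that is, there is an algorithm which, given any $L_p$-formula $\phi$, decides whether $\phi^{\mathfrak{C}}$ is the bottom element of $L_p/Z$ (i.e. whether $\phi$ is unsolvable in the coarse interpretation).
   Context: Languages. Fix an integer $p\ge 2$ (not necessarily prime). $L_p^{min}$ is the first-order language with a numeral for each natural number, a unary function symbol $-$, unary relation symbols $R_0,\dots,R_{p-1}$, and binary relation symbols $<$ and $=$. $L_p$ is $L_p^{min}$ expanded with binary function symbols $+$ and $\cdot$. The standard interpretation has domain $\mathbb{Z}$, with numerals, $-$, $<$, $=$, $+$, $\cdot$ having their usual meaning and $R_a$ denoting $\{n\in\mathbb{Z} : n\equiv a \pmod p\}$. The symbols $\le,>,\ge$ are abbreviations derived from $<$ and $=$. A formula is positive if its only connectives and quantifiers are among $\vee,\wedge,\forall,\exists$. Lindenbaum algebra. $Z$ is the set of $L_p$-formulas true in the standard interpretation under every assignment of integers to the variables. $L_p/Z$ is the set of equivalence classes $[\phi]$ of $L_p$-formulas, where $[\phi]=[\psi]$ iff $\phi\leftrightarrow\psi\in Z$, with order $[\phi]\le[\psi]$ iff $(\phi\rightarrow\psi)\in Z$ and with operations $\vee,\wedge,\neg,\exists x,\forall x$ induced by those on formulas. Equivalently, $[\phi]$ may be identified with the set of assignments of integers to variables satisfying $\phi$,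 with $\le$ being inclusion. The bottom element is the class of unsatisfiable formulas (the empty set of assignments). Approximations. $L_p^{min}$-formulas $\sigma(x,y,z)$, $\pi(x,y,z)$ with three free variables are approximations to the sum and product if $[x+y=z]\le[\sigma(x,y,z)]$ and $[x\cdot y=z]\le[\pi(x,y,z)]$ in $L_p/Z$. Coarse interpretation. Given approximations $\sigma,\pi$ to the sum and product, $\mathfrak{C}=\mathfrak{C}_{\sigma,\pi}$ assigns to formulas elements of $L_p/Z$ as follows (with $x,y,z$ arbitrary variables and $u$ a fresh variable): - $\phi^{\mathfrak{C}}=[\phi]$ for $\phi\in L_p^{min}$; - $(x+y=z)^{\mathfrak{C}}=\left[\bigvee_{0\le a<p}\bigvee_{0\le b<p}\left(R_a(x)\wedge R_b(y)\wedge R_{a+b \bmod p}(z)\right)\right]\wedge[\sigma(x,y,z)]$; - $(x+y<z)^{\mathfrak{C}}=\exists u\left((x+y=u)^{\mathfrak{C}}\wedge[u<z]\right)$; - $(x\cdot y=z)^{\mathfrak{C}}=\left[\bigvee_{0\le a<p}\bigvee_{0\le b<p}\left(R_a(x)\wedge R_b(y)\wedge R_{a\cdot b \bmod p}(z)\right)\right]\wedge[\pi(x,y,z)]$; - $(x\cdot y<z)^{\mathfrak{C}}=\exists u\left((x\cdot y=u)^{\mathfrak{C}}\wedge[u<z]\right)$; - $\mathfrak{C}$ commutes with $\vee,\wedge,\neg,\exists x,\forall x$, e.g. $(\phi\vee\psi)^{\mathfrak{C}}=\phi^{\mathfrak{C}}\vee\psi^{\mathfrak{C}}$ and $(\exists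 x\,\phi)^{\mathfrak{C}}=\exists x\,(\phi^{\mathfrak{C}})$. This defines $\phi^{\mathfrak{C}}$ for all formulas built by connectives and quantifiers from atomic $L_p^{min}$-formulas and the four atomic forms $x+y=z$, $x+y<z$, $x\cdot y=z$, $x\cdot y<z$. An arbitrary $L_p$-formula is interpreted by first applying a fixed algorithmic translation into a formula of this kind that is equivalent to it over the standard integers; the translation takes positive formulas to positive formulas and leaves formulas already of this kind unchanged. *)

theory Defs
  imports Main "HOL-Library.Nat_Bijection" "HOL-Number_Theory.Cong"
begin

section \<open>Syntax and standard interpretation\<close>

text \<open>
  Variables are de Bruijn indices: \<open>FEx\<close> and \<open>FAll\<close> bind index 0, and the free variables
  of a formula are indexed by the natural numbers. Implication and equivalence are
  the usual abbreviations. The symbols \<open>R\<^sub>a\<close> are available in the datatype for all \<open>a\<close>;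
  the set \<open>Lp p\<close> cuts this down to \<open>a < p\<close>.
\<close>

datatype tm = Var nat | Num nat | Neg tm | Add tm tm | Mul tm tm

datatype fm =
    Less tm tm | Eq tm tm | Rel nat tm
  | FNot fm | FAnd fm fm | FOr fm fm | FEx fm | FAll fm

abbreviation FImp :: "fm \<Rightarrow> fm \<Rightarrow> fm" where
  "FImp \<phi> \<psi> \<equiv> FOr (FNot \<phi>) \<psi>"

abbreviation FIff :: "fm \<Rightarrow> fm \<Rightarrow> fm" where
  "FIff \<phi> \<psi> \<equiv> FAnd (FImp \<phi> \<psi>) (FImp \<psi> \<phi>)"

primrec tm_val :: "(nat \<Rightarrow> int) \<Rightarrow> tm \<Rightarrow> int" where
  "tm_val e (Var i) = e i"
| "tm_val e (Num n) = int n"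
| "tm_val e (Neg t) = - tm_val e t"
| "tm_val e (Add s t) = tm_val e s + tm_val e t"
| "tm_val e (Mul s t) = tm_val e s * tm_val e t"

primrec sat :: "nat \<Rightarrow> (nat \<Rightarrow> int) \<Rightarrow> fm \<Rightarrow> bool" where
  "sat p e (Less s t) \<longleftrightarrow> tm_val e s < tm_val e t"
| "sat p e (Eq s t) \<longleftrightarrow> tm_val e s = tm_val e t"
| "sat p e (Rel a t) \<longleftrightarrow> [tm_val e t = int a] (mod int p)"
| "sat p e (FNot \<phi>) \<longleftrightarrow> \<not> sat p e \<phi>"
| "sat p e (FAnd \<phi> \<psi>) \<longleftrightarrow> sat p e \<phi> \<and> sat p e \<psi>"
| "sat p e (FOr \<phi> \<psi>) \<longleftrightarrow> sat p e \<phi> \<or> sat p e \<psi>"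
| "sat p e (FEx \<phi>) \<longleftrightarrow> (\<exists>n::int. sat p (case_nat n e) \<phi>)"
| "sat p e (FAll \<phi>) \<longleftrightarrow> (\<forall>n::int. sat p (case_nat n e) \<phi>)"

primrec min_tm :: "tm \<Rightarrow> bool" where
  "min_tm (Var i) \<longleftrightarrow> True"
| "min_tm (Num n) \<longleftrightarrow> True"
| "min_tm (Neg t) \<longleftrightarrow> min_tm t"
| "min_tm (Add s t) \<longleftrightarrow> False"
| "min_tm (Mul s t) \<longleftrightarrow> False"

inductive_set Lp :: "nat \<Rightarrow> fm set" for p where
  "Less s t \<in> Lp p"
| "Eq s t \<in> Lp p"
| "a < p \<Longrightarrow> Rel a t \<in> Lp p"
| "\<phi> \<in> Lp p \<Longrightarrow> FNot \<phi> \<in> Lp p"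
| "\<phi> \<in> Lp p \<Longrightarrow> \<psi> \<in> Lp p \<Longrightarrow> FAnd \<phi> \<psi> \<in> Lp p"
| "\<phi> \<in> Lp p \<Longrightarrow> \<psi> \<in> Lp p \<Longrightarrow> FOr \<phi> \<psi> \<in> Lp p"
| "\<phi> \<in> Lp p \<Longrightarrow> FEx \<phi> \<in> Lp p"
| "\<phi> \<in> Lp p \<Longrightarrow> FAll \<phi> \<in> Lp p"

inductive_set Lp_min :: "nat \<Rightarrow> fm set" for p where
  "min_tm s \<Longrightarrow> min_tm t \<Longrightarrow> Less s t \<in> Lp_min p"
| "min_tm s \<Longrightarrow> min_tm t \<Longrightarrow> Eq s t \<in> Lp_min p"
| "a < p \<Longrightarrow> min_tm t \<Longrightarrow> Rel a t \<in> Lp_min p"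
| "\<phi> \<in> Lp_min p \<Longrightarrow> FNot \<phi> \<in> Lp_min p"
| "\<phi> \<in> Lp_min p \<Longrightarrow> \<psi> \<in> Lp_min p \<Longrightarrow> FAnd \<phi> \<psi> \<in> Lp_min p"
| "\<phi> \<in> Lp_min p \<Longrightarrow> \<psi> \<in> Lp_min p \<Longrightarrow> FOr \<phi> \<psi> \<in> Lp_min p"
| "\<phi> \<in> Lp_min p \<Longrightarrow> FEx \<phi> \<in> Lp_min p"
| "\<phi> \<in> Lp_min p \<Longrightarrow> FAll \<phi> \<in> Lp_min p"

primrec positive :: "fm \<Rightarrow> bool" where
  "positive (Less s t) \<longleftrightarrow> True"
| "positive (Eq s t) \<longleftrightarrow> True"
| "positive (Rel a t) \<longleftrightarrow> True"
| "positive (FNot \<phi>) \<longleftrightarrow> False"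
| "positive (FAnd \<phi> \<psi>) \<longleftrightarrow> positive \<phi> \<and> positive \<psi>"
| "positive (FOr \<phi> \<psi>) \<longleftrightarrow> positive \<phi> \<and> positive \<psi>"
| "positive (FEx \<phi>) \<longleftrightarrow> positive \<phi>"
| "positive (FAll \<phi>) \<longleftrightarrow> positive \<phi>"

primrec tm_vars :: "tm \<Rightarrow> nat set" where
  "tm_vars (Var i) = {i}"
| "tm_vars (Num n) = {}"
| "tm_vars (Neg t) = tm_vars t"
| "tm_vars (Add s t) = tm_vars s \<union> tm_vars t"
| "tm_vars (Mul s t) = tm_vars s \<union> tm_vars t"

primrec free_vars :: "fm \<Rightarrow> nat set" where
  "free_vars (Less s t) = tm_vars s \<union> tm_vars t"
| "free_vars (Eq s t) = tm_vars s \<union> tm_vars t"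
| "free_vars (Rel a t) = tm_vars t"
| "free_vars (FNot \<phi>) = free_vars \<phi>"
| "free_vars (FAnd \<phi> \<psi>) = free_vars \<phi> \<union> free_vars \<psi>"
| "free_vars (FOr \<phi> \<psi>) = free_vars \<phi> \<union> free_vars \<psi>"
| "free_vars (FEx \<phi>) = {i. Suc i \<in> free_vars \<phi>}"
| "free_vars (FAll \<phi>) = {i. Suc i \<in> free_vars \<phi>}"

primrec tm_rename :: "(nat \<Rightarrow> nat) \<Rightarrow> tm \<Rightarrow> tm" where
  "tm_rename f (Var i) = Var (f i)"
| "tm_rename f (Num n) = Num n"
| "tm_rename f (Neg t) = Neg (tm_rename f t)"
| "tm_rename f (Add s t) = Add (tm_rename f s) (tm_rename f t)"
| "tm_rename f (Mul s t) = Mul (tm_rename f s) (tm_rename f t)"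

primrec rename :: "(nat \<Rightarrow> nat) \<Rightarrow> fm \<Rightarrow> fm" where
  "rename f (Less s t) = Less (tm_rename f s) (tm_rename f t)"
| "rename f (Eq s t) = Eq (tm_rename f s) (tm_rename f t)"
| "rename f (Rel a t) = Rel a (tm_rename f t)"
| "rename f (FNot \<phi>) = FNot (rename f \<phi>)"
| "rename f (FAnd \<phi> \<psi>) = FAnd (rename f \<phi>) (rename f \<psi>)"
| "rename f (FOr \<phi> \<psi>) = FOr (rename f \<phi>) (rename f \<psi>)"
| "rename f (FEx \<phi>) = FEx (rename (case_nat 0 (\<lambda>i. Suc (f i))) \<phi>)"
| "rename f (FAll \<phi>) = FAll (rename (case_nat 0 (\<lambda>i. Suc (f i))) \<phi>)"

text \<open>For a formula \<open>\<sigma>\<close> in the free variables 0, 1, 2, this is \<open>\<sigma>(x,y,z)\<close>.\<close>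

definition inst3 :: "fm \<Rightarrow> nat \<Rightarrow> nat \<Rightarrow> nat \<Rightarrow> fm" where
  "inst3 \<sigma> x y z = rename (\<lambda>i. if i = 0 then x else if i = 1 then y else z) \<sigma>"

section \<open>The Lindenbaum algebra\<close>

definition Z :: "nat \<Rightarrow> fm set" where
  "Z p = {\<phi> \<in> Lp p. \<forall>e. sat p e \<phi>}"

definition lind_rel :: "nat \<Rightarrow> (fm \<times> fm) set" where
  "lind_rel p = {(\<phi>, \<psi>). \<phi> \<in> Lp p \<and> \<psi> \<in> Lp p \<and> FIff \<phi> \<psi> \<in> Z p}"

definition cls :: "nat \<Rightarrow> fm \<Rightarrow> fm set" where
  "cls p \<phi> = lind_rel p `` {\<phi>}"

definition lindenbaum :: "nat \<Rightarrow> fm set set" where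
  "lindenbaum p = Lp p // lind_rel p"

definition lind_le :: "nat \<Rightarrow> fm set \<Rightarrow> fm set \<Rightarrow> bool" where
  "lind_le p A B \<longleftrightarrow> (\<exists>\<phi>\<in>A. \<exists>\<psi>\<in>B. FImp \<phi> \<psi> \<in> Z p)"

text \<open>Operations on classes induced by operations on formulas that respect \<open>lind_rel\<close>.\<close>

definition induced1 :: "nat \<Rightarrow> (fm \<Rightarrow> fm) \<Rightarrow> fm set \<Rightarrow> fm set" where
  "induced1 p F A = (\<Union>\<phi>\<in>A. cls p (F \<phi>))"

definition induced2 :: "nat \<Rightarrow> (fm \<Rightarrow> fm \<Rightarrow> fm) \<Rightarrow> fm set \<Rightarrow> fm set \<Rightarrow> fm set" where
  "induced2 p F A B = (\<Union>\<phi>\<in>A. \<Union>\<psi>\<in>B. cls p (F \<phi> \<psi>))"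

definition lind_bot :: "nat \<Rightarrow> fm set" where
  "lind_bot p = {\<phi> \<in> Lp p. \<not> (\<exists>e. sat p e \<phi>)}"

section \<open>Approximations and the coarse interpretation\<close>

definition approx_sum :: "nat \<Rightarrow> fm \<Rightarrow> bool" where
  "approx_sum p \<sigma> \<longleftrightarrow> \<sigma> \<in> Lp_min p \<and> free_vars \<sigma> \<subseteq> {0, 1, 2} \<and>
     lind_le p (cls p (Eq (Add (Var 0) (Var 1)) (Var 2))) (cls p \<sigma>)"

definition approx_prod :: "nat \<Rightarrow> fm \<Rightarrow> bool" where
  "approx_prod p \<pi> \<longleftrightarrow> \<pi> \<in> Lp_min p \<and> free_vars \<pi> \<subseteq> {0, 1, 2} \<and>
     lind_le p (cls p (Eq (Mul (Var 0) (Var 1)) (Var 2))) (cls p \<pi>)"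

text \<open>The last disjunct is unsatisfiable; it serves as the empty disjunction.\<close>

definition disj :: "fm list \<Rightarrow> fm" where
  "disj \<phi>s = foldr FOr \<phi>s (Less (Num 0) (Num 0))"

definition residues_fm :: "nat \<Rightarrow> (nat \<Rightarrow> nat \<Rightarrow> nat) \<Rightarrow> nat \<Rightarrow> nat \<Rightarrow> nat \<Rightarrow> fm" where
  "residues_fm p f x y z =
     disj [FAnd (Rel a (Var x)) (FAnd (Rel b (Var y)) (Rel (f a b mod p) (Var z))).
             a \<leftarrow> [0..<p], b \<leftarrow> [0..<p]]"

text \<open>
  With \<open>f\<close> addition and \<open>\<alpha> = \<sigma>\<close>, \<open>coarse_eq\<close> interprets \<open>x + y = z\<close> and \<open>coarse_less\<close>
  interprets \<open>x + y < z\<close>; with \<open>f\<close> multiplication and \<open>\<alpha> = \<pi>\<close>, the same for products.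
  In \<open>coarse_less\<close> the fresh variable is the bound index 0, so \<open>x, y, z\<close> are shifted.
\<close>

definition coarse_eq :: "nat \<Rightarrow> (nat \<Rightarrow> nat \<Rightarrow> nat) \<Rightarrow> fm \<Rightarrow> nat \<Rightarrow> nat \<Rightarrow> nat \<Rightarrow> fm set" where
  "coarse_eq p f \<alpha> x y z = induced2 p FAnd (cls p (residues_fm p f x y z)) (cls p (inst3 \<alpha> x y z))"

definition coarse_less :: "nat \<Rightarrow> (nat \<Rightarrow> nat \<Rightarrow> nat) \<Rightarrow> fm \<Rightarrow> nat \<Rightarrow> nat \<Rightarrow> nat \<Rightarrow> fm set" where
  "coarse_less p f \<alpha> x y z =
     induced1 p FEx
       (induced2 p FAnd (coarse_eq p f \<alpha> (Suc x) (Suc y) 0) (cls p (Less (Var 0) (Var (Suc z)))))"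

text \<open>
  The formulas on which the coarse interpretation is defined directly: those built from
  atomic formulas of the minimal language and the four atomic forms in \<open>+\<close> and \<open>\<cdot>\<close>.
\<close>

inductive_set basic :: "nat \<Rightarrow> fm set" for p where
  "min_tm s \<Longrightarrow> min_tm t \<Longrightarrow> Less s t \<in> basic p"
| "min_tm s \<Longrightarrow> min_tm t \<Longrightarrow> Eq s t \<in> basic p"
| "a < p \<Longrightarrow> min_tm t \<Longrightarrow> Rel a t \<in> basic p"
| "Eq (Add (Var x) (Var y)) (Var z) \<in> basic p"
| "Less (Add (Var x) (Var y)) (Var z) \<in> basic p"
| "Eq (Mul (Var x) (Var y)) (Var z) \<in> basic p"
| "Less (Mul (Var x) (Var y)) (Var z) \<in> basic p"
| "\<phi> \<in> basic p \<Longrightarrow> FNot \<phi> \<in> basic p"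
| "\<phi> \<in> basic p \<Longrightarrow> \<psi> \<in> basic p \<Longrightarrow> FAnd \<phi> \<psi> \<in> basic p"
| "\<phi> \<in> basic p \<Longrightarrow> \<psi> \<in> basic p \<Longrightarrow> FOr \<phi> \<psi> \<in> basic p"
| "\<phi> \<in> basic p \<Longrightarrow> FEx \<phi> \<in> basic p"
| "\<phi> \<in> basic p \<Longrightarrow> FAll \<phi> \<in> basic p"

text \<open>Only the values on \<open>basic p\<close> are meaningful.\<close>

primrec coarse_basic :: "nat \<Rightarrow> fm \<Rightarrow> fm \<Rightarrow> fm \<Rightarrow> fm set" where
  "coarse_basic p \<sigma> \<pi> (Eq s t) =
     (case (s, t) of
        (Add (Var x) (Var y), Var z) \<Rightarrow> coarse_eq p (+) \<sigma> x y z
      | (Mul (Var x) (Var y), Var z) \<Rightarrow> coarse_eq p (*) \<pi> x y z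
      | _ \<Rightarrow> cls p (Eq s t))"
| "coarse_basic p \<sigma> \<pi> (Less s t) =
     (case (s, t) of
        (Add (Var x) (Var y), Var z) \<Rightarrow> coarse_less p (+) \<sigma> x y z
      | (Mul (Var x) (Var y), Var z) \<Rightarrow> coarse_less p (*) \<pi> x y z
      | _ \<Rightarrow> cls p (Less s t))"
| "coarse_basic p \<sigma> \<pi> (Rel a t) = cls p (Rel a t)"
| "coarse_basic p \<sigma> \<pi> (FNot \<phi>) = induced1 p FNot (coarse_basic p \<sigma> \<pi> \<phi>)"
| "coarse_basic p \<sigma> \<pi> (FAnd \<phi> \<psi>) =
     induced2 p FAnd (coarse_basic p \<sigma> \<pi> \<phi>) (coarse_basic p \<sigma> \<pi> \<psi>)"
| "coarse_basic p \<sigma> \<pi> (FOr \<phi> \<psi>) =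
     induced2 p FOr (coarse_basic p \<sigma> \<pi> \<phi>) (coarse_basic p \<sigma> \<pi> \<psi>)"
| "coarse_basic p \<sigma> \<pi> (FEx \<phi>) = induced1 p FEx (coarse_basic p \<sigma> \<pi> \<phi>)"
| "coarse_basic p \<sigma> \<pi> (FAll \<phi>) = induced1 p FAll (coarse_basic p \<sigma> \<pi> \<phi>)"

definition coarse :: "nat \<Rightarrow> fm \<Rightarrow> fm \<Rightarrow> (fm \<Rightarrow> fm) \<Rightarrow> fm \<Rightarrow> fm set" where
  "coarse p \<sigma> \<pi> tr \<phi> = coarse_basic p \<sigma> \<pi> (tr \<phi>)"

section \<open>Computability\<close>

text \<open>
  The total recursive functions. \<open>recursive n f\<close> says that \<open>f\<close>, restricted to argument lists
  of length \<open>n\<close>, is a total recursive function of \<open>n\<close> arguments; values of \<open>f\<close> on lists of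
  another length are irrelevant. Minimization is applied to functions having a zero for all
  values of the parameters, which is known to yield all total computable functions.
\<close>

inductive recursive :: "nat \<Rightarrow> (nat list \<Rightarrow> nat) \<Rightarrow> bool" where
  rec_zero: "recursive n (\<lambda>xs. 0)"
| rec_succ: "recursive 1 (\<lambda>xs. Suc (hd xs))"
| rec_proj: "i < n \<Longrightarrow> recursive n (\<lambda>xs. xs ! i)"
| rec_comp: "recursive (length gs) f \<Longrightarrow> \<forall>g\<in>set gs. recursive n g \<Longrightarrow>
    recursive n (\<lambda>xs. f (map (\<lambda>g. g xs) gs))"
| rec_prim: "recursive n f \<Longrightarrow> recursive (Suc (Suc n)) g \<Longrightarrow>
    recursive (Suc n) (\<lambda>xs. rec_nat (f (tl xs)) (\<lambda>k r. g (k # r # tl xs)) (hd xs))"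
| rec_mu: "recursive (Suc n) f \<Longrightarrow> \<forall>xs. length xs = n \<longrightarrow> (\<exists>k. f (k # xs) = 0) \<Longrightarrow>
    recursive n (\<lambda>xs. LEAST k. f (k # xs) = 0)"

text \<open>Goedel numbering, via the Cantor pairing function \<open>prod_encode\<close>.\<close>

primrec code_tm :: "tm \<Rightarrow> nat" where
  "code_tm (Var i) = prod_encode (0, i)"
| "code_tm (Num n) = prod_encode (1, n)"
| "code_tm (Neg t) = prod_encode (2, code_tm t)"
| "code_tm (Add s t) = prod_encode (3, prod_encode (code_tm s, code_tm t))"
| "code_tm (Mul s t) = prod_encode (4, prod_encode (code_tm s, code_tm t))"

primrec code_fm :: "fm \<Rightarrow> nat" where
  "code_fm (Less s t) = prod_encode (0, prod_encode (code_tm s, code_tm t))"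
| "code_fm (Eq s t) = prod_encode (1, prod_encode (code_tm s, code_tm t))"
| "code_fm (Rel a t) = prod_encode (2, prod_encode (a, code_tm t))"
| "code_fm (FNot \<phi>) = prod_encode (3, code_fm \<phi>)"
| "code_fm (FAnd \<phi> \<psi>) = prod_encode (4, prod_encode (code_fm \<phi>, code_fm \<psi>))"
| "code_fm (FOr \<phi> \<psi>) = prod_encode (5, prod_encode (code_fm \<phi>, code_fm \<psi>))"
| "code_fm (FEx \<phi>) = prod_encode (6, code_fm \<phi>)"
| "code_fm (FAll \<phi>) = prod_encode (7, code_fm \<phi>)"

lemma code_tm_inject: "code_tm s = code_tm t \<longleftrightarrow> s = t"
proof (induction s arbitrary: t)
  case (Var i) then show ?case by (cases t) auto
next
  case (Num n) then show ?case by (cases t) auto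
next
  case (Neg s) then show ?case by (cases t) auto
next
  case (Add s1 s2) then show ?case by (cases t) auto
next
  case (Mul s1 s2) then show ?case by (cases t) auto
qed

lemma code_fm_inject: "code_fm \<phi> = code_fm \<psi> \<longleftrightarrow> \<phi> = \<psi>"
proof (induction \<phi> arbitrary: \<psi>)
  case (Less s t) then show ?case by (cases \<psi>) (auto simp: code_tm_inject)
next
  case (Eq s t) then show ?case by (cases \<psi>) (auto simp: code_tm_inject)
next
  case (Rel a t) then show ?case by (cases \<psi>) (auto simp: code_tm_inject)
next
  case (FNot \<phi>) then show ?case by (cases \<psi>) auto
next
  case (FAnd \<phi>1 \<phi>2) then show ?case by (cases \<psi>) auto
next
  case (FOr \<phi>1 \<phi>2) then show ?case by (cases \<psi>) auto
next
  case (FEx \<phi>) then show ?case by (cases \<psi>) auto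
next
  case (FAll \<phi>) then show ?case by (cases \<psi>) auto
qed

definition computable_on :: "fm set \<Rightarrow> (fm \<Rightarrow> fm) \<Rightarrow> bool" where
  "computable_on L F \<longleftrightarrow>
     (\<exists>f. recursive 1 f \<and> (\<forall>\<phi>\<in>L. f [code_fm \<phi>] = code_fm (F \<phi>)))"

definition decidable_on :: "fm set \<Rightarrow> (fm \<Rightarrow> bool) \<Rightarrow> bool" where
  "decidable_on L P \<longleftrightarrow>
     (\<exists>f. recursive 1 f \<and> (\<forall>\<phi>\<in>L. f [code_fm \<phi>] = (if P \<phi> then 1 else 0)))"

text \<open>The algorithmic translations of arbitrary formulas into \<open>basic p\<close> that may be fixed.\<close>

definition translation :: "nat \<Rightarrow> (fm \<Rightarrow> fm) \<Rightarrow> bool" where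
  "translation p tr \<longleftrightarrow>
     computable_on (Lp p) tr \<and>
     (\<forall>\<phi>\<in>Lp p. tr \<phi> \<in> basic p \<and> FIff \<phi> (tr \<phi>) \<in> Z p \<and> (positive \<phi> \<longrightarrow> positive (tr \<phi>))) \<and>
     (\<forall>\<phi>\<in>basic p. tr \<phi> = \<phi>)"

end

theory Submission
  imports Defs
begin

text \<open>
  Replacing the atoms \<open>x + y = z\<close>, \<open>x + y < z\<close>, \<open>x \<cdot> y = z\<close>, \<open>x \<cdot> y < z\<close> by the formulas that interpret
  them turns a formula \<open>\<psi>\<close> into an equivalent one of the minimal language, so it suffices to decide
  satisfiability there, uniformly in \<open>\<psi>\<close>. The minimal language sees of a tuple of integers only
  the residues modulo \<open>p\<close> and the differences of the points \<open>0, \<plusminus>x\<^sub>i\<close>, truncated at some radius. Adding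
  one more point costs a bounded factor in the radius (an Ehrenfeucht-Fraisse argument), and the new
  point can be chosen close to an old one. Hence every quantifier may be restricted to integers bounded
  by a computable function of the code of the formula and of the current values of the variables,
  and truth can be evaluated by primitive recursion on the code. Free variables
  are handled by prefixing existential quantifiers.
\<close>

section \<open>A calculus of computable functions\<close>

text \<open>Truth below a quantifier recurs with a changed environment, whereas
  \<open>recursive\<close> only offers primitive recursion with fixed parameters. The evaluation
  therefore tabulates, code by code, the truth values in all environments below one bound fixed in
  advance (\<open>env_bound\<close>), packed into the bits of a single number. Such a bound exists
  because every quantifier has been bounded. The interpretations of the four atomic forms involve
  the arbitrary formulas \<open>\<sigma>\<close> and \<open>\<pi>\<close>, but written in the
  variables 0, 1, 2 they are fixed formulas. \<open>decidable_sat\<close> yields an algorithm for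
  each of them by an induction outside the calculus, and the evaluation on codes calls these
  algorithms on the values of the variables. Because the language has negation, points come in pairs
  \<open>x\<close>, \<open>- x\<close> at distance \<open>2 * x\<close>. Controlling this doubled
  distance is what costs the factor 3 in the radius. Numerals are not treated as points but as
  offsets from 0, paid for by a larger radius.\<close>

definition total_recursive :: "nat \<Rightarrow> (nat list \<Rightarrow> nat) \<Rightarrow> bool" where
  "total_recursive n f \<longleftrightarrow> (\<exists>g. recursive n g \<and> (\<forall>xs. length xs = n \<longrightarrow> g xs = f xs))"

lemma total_recursiveI: "recursive n f \<Longrightarrow> total_recursive n f"
  by (auto simp: total_recursive_def)

text \<open>The reason for passing from \<open>recursive\<close> to \<open>total_recursive\<close>:
  the former concerns a function on lists of every length, while agreement is only available, and
  only matters, at length \<open>n\<close>.\<close>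

lemma total_recursive_cong:
  assumes "total_recursive n f" "\<And>xs. length xs = n \<Longrightarrow> f xs = g xs"
  shows "total_recursive n g"
  using assms by (auto simp: total_recursive_def)

lemma total_recursive_comp:
  assumes f: "total_recursive (length gs) f" and gs: "\<And>g. g \<in> set gs \<Longrightarrow> total_recursive n g"
  shows "total_recursive n (\<lambda>xs. f (map (\<lambda>g. g xs) gs))"
proof -
  obtain f' where f': "recursive (length gs) f'" "\<And>xs. length xs = length gs \<Longrightarrow> f' xs = f xs"
    using f by (auto simp: total_recursive_def)
  obtain h where h: "\<And>g. g \<in> set gs \<Longrightarrow> recursive n (h g)"
    "\<And>g xs. g \<in> set gs \<Longrightarrow> length xs = n \<Longrightarrow> h g xs = g xs"
    using gs unfolding total_recursive_def by metis
  have "recursive n (\<lambda>xs. f' (map (\<lambda>g. g xs) (map h gs)))"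
    using f'(1) h(1) by (intro rec_comp) auto
  moreover have "f' (map (\<lambda>g. g xs) (map h gs)) = f (map (\<lambda>g. g xs) gs)" if "length xs = n" for xs
  proof -
    have "map (\<lambda>g. g xs) (map h gs) = map (\<lambda>g. g xs) gs"
      using h(2) that by auto
    then show ?thesis using f'(2)[of "map (\<lambda>g. g xs) (map h gs)"] by (simp del: map_map)
  qed
  ultimately show ?thesis unfolding total_recursive_def by blast
qed

lemma total_recursive_comp1:
  assumes "total_recursive 1 (\<lambda>xs. f (xs ! 0))" "total_recursive n g"
  shows "total_recursive n (\<lambda>xs. f (g xs))"
  using total_recursive_comp[of "[g]" "\<lambda>xs. f (xs ! 0)" n] assms by simp

lemma total_recursive_comp2:
  assumes "total_recursive 2 (\<lambda>xs. f (xs ! 0) (xs ! 1))" "total_recursive n g" "total_recursive n h"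
  shows "total_recursive n (\<lambda>xs. f (g xs) (h xs))"
proof -
  have "total_recursive (length [g, h]) (\<lambda>xs. f (xs ! 0) (xs ! 1))"
    using assms(1) by (simp add: numeral_2_eq_2)
  from total_recursive_comp[OF this, of n] assms(2,3) show ?thesis by auto
qed

lemma total_recursive_prim:
  assumes "total_recursive n f" "total_recursive (Suc (Suc n)) g"
  shows "total_recursive (Suc n) (\<lambda>xs. rec_nat (f (tl xs)) (\<lambda>k r. g (k # r # tl xs)) (hd xs))"
proof -
  obtain f' g' where r: "recursive n f'" "recursive (Suc (Suc n)) g'"
    and e: "\<And>xs. length xs = n \<Longrightarrow> f' xs = f xs" "\<And>xs. length xs = Suc (Suc n) \<Longrightarrow> g' xs = g xs"
    using assms by (auto simp: total_recursive_def)
  have "rec_nat (f' (tl xs)) (\<lambda>k r. g' (k # r # tl xs)) m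
      = rec_nat (f (tl xs)) (\<lambda>k r. g (k # r # tl xs)) m" if "length xs = Suc n" for xs m
    using that by (induction m) (auto simp: e)
  then show ?thesis
    using rec_prim[OF r] unfolding total_recursive_def by blast
qed

lemma total_recursive_mu:
  assumes "total_recursive (Suc n) f" and ex: "\<And>xs. length xs = n \<Longrightarrow> \<exists>k. f (k # xs) = 0"
  shows "total_recursive n (\<lambda>xs. LEAST k. f (k # xs) = 0)"
proof -
  obtain f' where r: "recursive (Suc n) f'" and e: "\<And>xs. length xs = Suc n \<Longrightarrow> f' xs = f xs"
    using assms(1) by (auto simp: total_recursive_def)
  have "recursive n (\<lambda>xs. LEAST k. f' (k # xs) = 0)"
    using ex e by (intro rec_mu[OF r]) auto
  then show ?thesis
    unfolding total_recursive_def using e by (intro exI conjI) auto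
qed

lemma length2E:
  assumes "length xs = 2" obtains x y where "xs = [x, y]"
  using assms by (auto simp: numeral_2_eq_2 length_Suc_conv)

lemma total_recursive_proj: "i < n \<Longrightarrow> total_recursive n (\<lambda>xs. xs ! i)"
  by (intro total_recursiveI rec_proj)

lemma total_recursive_Suc:
  assumes "total_recursive n f" shows "total_recursive n (\<lambda>xs. Suc (f xs))"
proof (rule total_recursive_comp1[of Suc, OF _ assms])
  show "total_recursive 1 (\<lambda>xs. Suc (xs ! 0))"
    by (rule total_recursive_cong[OF total_recursiveI[OF rec_succ]]) (auto simp: length_Suc_conv)
qed

lemma total_recursive_prim1:
  assumes "total_recursive 2 (\<lambda>xs. g (xs ! 0) (xs ! 1))"
  shows "total_recursive 1 (\<lambda>xs. rec_nat c g (xs ! 0))"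
proof -
  have c: "total_recursive 0 (\<lambda>xs. c)"
    by (induction c) (auto intro: total_recursiveI rec_zero total_recursive_Suc)
  have g: "total_recursive (Suc (Suc 0)) (\<lambda>xs. g (xs ! 0) (xs ! 1))"
    using assms by (simp add: numeral_2_eq_2)
  show ?thesis
    unfolding One_nat_def
    by (rule total_recursive_cong[OF total_recursive_prim[OF c g]]) (auto simp: length_Suc_conv)
qed

lemma total_recursive_prim2:
  assumes "total_recursive 1 (\<lambda>xs. f (xs ! 0))" "total_recursive 3 (\<lambda>xs. g (xs ! 0) (xs ! 1) (xs ! 2))"
  shows "total_recursive 2 (\<lambda>xs. rec_nat (f (xs ! 1)) (\<lambda>k r. g k r (xs ! 1)) (xs ! 0))"
proof -
  have g: "total_recursive (Suc (Suc 1)) (\<lambda>xs. g (xs ! 0) (xs ! 1) (xs ! 2))"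
    using assms(2) by (simp add: numeral_3_eq_3)
  have "Suc 1 = 2" by simp
  from total_recursive_prim[OF assms(1) g] show ?thesis
    unfolding \<open>Suc 1 = 2\<close>
    by (rule total_recursive_cong) (auto elim!: length2E)
qed

lemma total_recursive_add: "total_recursive 2 (\<lambda>xs. xs ! 0 + xs ! 1)"
proof -
  have "rec_nat y (\<lambda>k r. Suc r) x = x + y" for x y :: nat
    by (induction x) auto
  moreover have "total_recursive 2 (\<lambda>xs. rec_nat (xs ! 1) (\<lambda>k r. Suc r) (xs ! 0))"
    by (rule total_recursive_prim2[of "\<lambda>y. y" "\<lambda>k r y. Suc r"])
      (auto intro!: total_recursive_Suc total_recursive_proj)
  ultimately show ?thesis by simp
qed

text \<open>The recursion runs on the number subtracted, which has to be the first argument; hence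
  the reversed order.\<close>

lemma total_recursive_diff: "total_recursive 2 (\<lambda>xs. xs ! 1 - xs ! 0)"
proof -
  have pred: "total_recursive 1 (\<lambda>xs. xs ! 0 - 1)"
  proof -
    have "rec_nat 0 (\<lambda>k r. k) x = x - 1" for x :: nat
      by (cases x) auto
    moreover have "total_recursive 1 (\<lambda>xs. rec_nat 0 (\<lambda>k r. k) (xs ! 0))"
      by (rule total_recursive_prim1[of "\<lambda>k r. k"]) (auto intro!: total_recursive_proj)
    ultimately show ?thesis by simp
  qed
  have "rec_nat y (\<lambda>k r. r - 1) x = y - x" for x y :: nat
    by (induction x) auto
  moreover have "total_recursive 2 (\<lambda>xs. rec_nat (xs ! 1) (\<lambda>k r. r - 1) (xs ! 0))"
    by (intro total_recursive_prim2[of "\<lambda>y. y" "\<lambda>k r y. r - 1"]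
        total_recursive_comp1[OF pred] total_recursive_proj) auto
  ultimately show ?thesis by simp
qed

section \<open>Cantor pairing and its projections\<close>

lemma total_recursive_triangle: "total_recursive 1 (\<lambda>xs. triangle (xs ! 0))"
proof -
  have "rec_nat 0 (\<lambda>k r. r + Suc k) x = triangle x" for x :: nat
    by (induction x) auto
  moreover have "total_recursive 1 (\<lambda>xs. rec_nat 0 (\<lambda>k r. r + Suc k) (xs ! 0))"
    by (rule total_recursive_prim1[of "\<lambda>k r. r + Suc k"])
      (auto intro!: total_recursive_comp2[OF total_recursive_add] total_recursive_Suc total_recursive_proj)
  ultimately show ?thesis by simp
qed

lemma total_recursive_prod_encode: "total_recursive 2 (\<lambda>xs. prod_encode (xs ! 0, xs ! 1))"
  unfolding prod_encode_def split
  by (intro total_recursive_comp2[OF total_recursive_add] total_recursive_comp1[OF total_recursive_triangle]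
      total_recursive_proj) auto

definition pfst :: "nat \<Rightarrow> nat" where "pfst z = fst (prod_decode z)"
definition psnd :: "nat \<Rightarrow> nat" where "psnd z = snd (prod_decode z)"

lemma pfst_encode [simp]: "pfst (prod_encode (a, b)) = a"
  and psnd_encode [simp]: "psnd (prod_encode (a, b)) = b"
  and prod_encode_pfst_psnd [simp]: "prod_encode (pfst z, psnd z) = z"
  by (auto simp: pfst_def psnd_def)

lemma mono_triangle: "m \<le> n \<Longrightarrow> triangle m \<le> triangle n"
  by (induction n) (auto simp: le_Suc_eq)

lemma add_le_prod_encode: "a + b \<le> prod_encode (a, b)"
proof -
  have "n \<le> triangle n" for n by (induction n) auto
  then show ?thesis unfolding prod_encode_def split by (meson trans_le_add1)
qed

lemma le_prod_encode: "i \<le> a \<Longrightarrow> i \<le> prod_encode (a, b)" "i \<le> b \<Longrightarrow> i \<le> prod_encode (a, b)"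
  using add_le_prod_encode[of a b] by linarith+

lemma prod_encode_less: "0 < t \<Longrightarrow> x < prod_encode (t, x)"
  using add_le_prod_encode[of t x] by linarith

lemma prod_encode_mono:
  assumes "a \<le> c" "b \<le> d" shows "prod_encode (a, b) \<le> prod_encode (c, d)"
  using assms mono_triangle[of "a + b" "c + d"] by (simp add: prod_encode_def)

lemma pfst_plus_psnd_le: "pfst z + psnd z \<le> z"
  using add_le_prod_encode[of "pfst z" "psnd z"] by simp

text \<open>With \<open>s = a + b\<close> the code \<open>triangle s + a\<close> lies in the
  interval from \<open>triangle s\<close> up to but excluding \<open>triangle (Suc s)\<close>, so
  \<open>s\<close> is the least number with \<open>z < triangle (Suc s)\<close>; truncated
  subtraction expresses this as a zero. Both projections follow from \<open>s\<close>, and this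
  search is the only place where the calculus applies minimization.\<close>

lemma triangle_root: "pfst z + psnd z = (LEAST s. Suc z - triangle (Suc s) = 0)"
proof (rule Least_equality[symmetric])
  define a b where "a = pfst z" and "b = psnd z"
  have z: "z = triangle (a + b) + a"
    using prod_encode_pfst_psnd[of z] by (simp add: prod_encode_def a_def b_def)
  show "Suc z - triangle (Suc (pfst z + psnd z)) = 0"
    unfolding a_def[symmetric] b_def[symmetric] by (simp add: z)
  show "pfst z + psnd z \<le> s" if s: "Suc z - triangle (Suc s) = 0" for s
  proof (rule ccontr)
    assume "\<not> pfst z + psnd z \<le> s"
    then have "triangle (Suc s) \<le> triangle (a + b)"
      by (intro mono_triangle) (simp add: a_def b_def)
    with s show False by (simp add: z)
  qed
qed

lemma total_recursive_triangle_root: "total_recursive 1 (\<lambda>xs. pfst (xs ! 0) + psnd (xs ! 0))"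
proof -
  have "total_recursive (Suc 1) (\<lambda>xs. Suc (xs ! 1) - triangle (Suc (xs ! 0)))"
    by (intro total_recursive_comp2[OF total_recursive_diff, of "Suc 1" "\<lambda>xs. triangle (Suc (xs ! 0))"]
        total_recursive_comp1[OF total_recursive_triangle] total_recursive_Suc total_recursive_proj) auto
  then have "total_recursive 1 (\<lambda>xs. LEAST k. Suc ((k # xs) ! 1) - triangle (Suc ((k # xs) ! 0)) = 0)"
  proof (rule total_recursive_mu)
    fix xs :: "nat list"
    have "\<exists>k. Suc z - triangle (Suc k) = 0" for z
      by (rule exI[of _ "z"]) simp
    then show "\<exists>k. Suc ((k # xs) ! 1) - triangle (Suc ((k # xs) ! 0)) = 0" by simp
  qed
  then show ?thesis by (simp add: triangle_root)
qed

lemma total_recursive_pfst: "total_recursive 1 (\<lambda>xs. pfst (xs ! 0))"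
proof -
  have "pfst z = z - triangle (pfst z + psnd z)" for z
    using prod_encode_pfst_psnd[of z] unfolding prod_encode_def split by linarith
  moreover have "total_recursive 1 (\<lambda>xs. xs ! 0 - triangle (pfst (xs ! 0) + psnd (xs ! 0)))"
    by (intro total_recursive_comp2[OF total_recursive_diff, of 1 "\<lambda>xs. triangle (pfst (xs ! 0) + psnd (xs ! 0))"]
        total_recursive_comp1[OF total_recursive_triangle] total_recursive_triangle_root total_recursive_proj) auto
  ultimately show ?thesis by simp
qed

lemma total_recursive_psnd: "total_recursive 1 (\<lambda>xs. psnd (xs ! 0))"
proof -
  have "total_recursive 1 (\<lambda>xs. (pfst (xs ! 0) + psnd (xs ! 0)) - pfst (xs ! 0))"
    by (intro total_recursive_comp2[OF total_recursive_diff, of 1 "\<lambda>xs. pfst (xs ! 0)"]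
        total_recursive_triangle_root total_recursive_pfst)
  then show ?thesis by simp
qed

text \<open>One argument suffices because pairing packs several into one number. Expressions below a
  sum or a bounded quantifier become functions of a pair through \<open>pfst\<close> and
  \<open>psnd\<close>, so computability can be proved by introduction rules that follow the
  syntax.\<close>

definition computable :: "(nat \<Rightarrow> nat) \<Rightarrow> bool" where
  "computable f \<longleftrightarrow> total_recursive 1 (\<lambda>xs. f (xs ! 0))"

lemma computable_iff: "computable f \<longleftrightarrow> (\<exists>g. recursive 1 g \<and> (\<forall>x. g [x] = f x))"
  unfolding computable_def total_recursive_def
  by (simp add: length_Suc_conv) (metis nth_Cons_0)

named_theorems computable_intros

text \<open>Kept out of \<open>computable_intros\<close>, since its conclusion matches a goal in too
  many ways. It is supplied with a premise filled in, for a given function that reappears below a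
  binder.\<close>

lemma computable_comp:
  assumes "computable g" "computable f"
  shows "computable (\<lambda>x. g (f x))"
  using assms unfolding computable_def by (rule total_recursive_comp1)

lemma computable_id [computable_intros]: "computable (\<lambda>x. x)"
  unfolding computable_def by (rule total_recursive_proj) simp

lemma computable_Suc [computable_intros]: "computable f \<Longrightarrow> computable (\<lambda>x. Suc (f x))"
  unfolding computable_def by (rule total_recursive_Suc)

lemma computable_const [computable_intros]: "computable (\<lambda>x. c)"
proof (induction c)
  case 0
  show ?case unfolding computable_def by (intro total_recursiveI rec_zero)
next
  case (Suc c)
  then show ?case by (rule computable_Suc)
qed

lemma computable_pair [computable_intros]:
  "computable f \<Longrightarrow> computable g \<Longrightarrow> computable (\<lambda>x. prod_encode (f x, g x))"
  unfolding computable_def by (rule total_recursive_comp2[OF total_recursive_prod_encode])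

lemma computable_pfst [computable_intros]: "computable f \<Longrightarrow> computable (\<lambda>x. pfst (f x))"
  unfolding computable_def by (rule total_recursive_comp1[OF total_recursive_pfst])

lemma computable_psnd [computable_intros]: "computable f \<Longrightarrow> computable (\<lambda>x. psnd (f x))"
  unfolding computable_def by (rule total_recursive_comp1[OF total_recursive_psnd])

lemma computable_add [computable_intros]:
  "computable f \<Longrightarrow> computable g \<Longrightarrow> computable (\<lambda>x. f x + g x)"
  unfolding computable_def by (rule total_recursive_comp2[OF total_recursive_add])

lemma computable_diff [computable_intros]:
  "computable f \<Longrightarrow> computable g \<Longrightarrow> computable (\<lambda>x. f x - g x)"
  unfolding computable_def
  by (rule total_recursive_comp2[OF total_recursive_diff, of 1 "\<lambda>xs. g (xs ! 0)" "\<lambda>xs. f (xs ! 0)"])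

lemma computable_comp2:
  assumes "computable (\<lambda>y. h (pfst y) (psnd y))" "computable f" "computable g"
  shows "computable (\<lambda>x. h (f x) (g x))"
  using computable_comp[OF assms(1) computable_pair[OF assms(2,3)]] by simp

lemma computable_comp3:
  assumes "computable (\<lambda>y. h (pfst y) (pfst (psnd y)) (psnd (psnd y)))"
    "computable f" "computable g" "computable k"
  shows "computable (\<lambda>x. h (f x) (g x) (k x))"
  using computable_comp[OF assms(1) computable_pair[OF assms(2) computable_pair[OF assms(3,4)]]] by simp

lemma computable_rec_nat [computable_intros]:
  assumes a: "computable a" and m: "computable m"
    and b: "computable (\<lambda>y. b (pfst y) (pfst (psnd y)) (psnd (psnd y)))"
  shows "computable (\<lambda>x. rec_nat (a x) (\<lambda>k r. b k r x) (m x))"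
proof -
  have "total_recursive 3 (\<lambda>xs. prod_encode (xs ! 0, prod_encode (xs ! 1, xs ! 2)))"
    by (rule total_recursive_comp2[OF total_recursive_prod_encode],
        (rule total_recursive_comp2[OF total_recursive_prod_encode])?, simp_all add: total_recursive_proj)+
  from total_recursive_comp1[OF b[unfolded computable_def] this]
  have "total_recursive 3 (\<lambda>xs. b (xs ! 0) (xs ! 1) (xs ! 2))" by simp
  from total_recursive_prim2[OF a[unfolded computable_def] this]
  show ?thesis
    unfolding computable_def
    by (rule total_recursive_comp2[where f = "\<lambda>n x. rec_nat (a x) (\<lambda>k r. b k r x) n"])
      (use m in \<open>auto simp: computable_def total_recursive_proj\<close>)
qed

lemma computable_mult [computable_intros]:
  assumes "computable f" "computable g" shows "computable (\<lambda>x. f x * g x)"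
proof -
  have "rec_nat 0 (\<lambda>k r. r + n) m = m * n" for m n :: nat
    by (induction m) auto
  moreover have "computable (\<lambda>x. rec_nat 0 (\<lambda>k r. r + g x) (f x))"
    by (intro computable_intros assms computable_comp[OF assms(2)])
  ultimately show ?thesis by simp
qed

lemma computable_power [computable_intros]:
  assumes "computable f" "computable g" shows "computable (\<lambda>x. f x ^ g x)"
proof -
  have "rec_nat 1 (\<lambda>k r. r * m) n = m ^ n" for m n :: nat
    by (induction n) auto
  moreover have "computable (\<lambda>x. rec_nat 1 (\<lambda>k r. r * f x) (g x))"
    by (intro computable_intros assms computable_comp[OF assms(1)])
  ultimately show ?thesis by simp
qed

lemma computable_funpow:
  assumes "computable (\<lambda>y. h (pfst y) (psnd y))" "computable f" "computable n"
  shows "computable (\<lambda>x. ((\<lambda>r. h r x) ^^ n x) (f x))"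
proof -
  have "rec_nat a (\<lambda>k r. h r x) m = ((\<lambda>r. h r x) ^^ m) a" for a x m
    by (induction m) auto
  moreover have "computable (\<lambda>x. rec_nat (f x) (\<lambda>k r. h r x) (n x))"
    by (intro computable_intros assms computable_comp2[OF assms(1)])
  ultimately show ?thesis by simp
qed

lemma computable_sum [computable_intros]:
  assumes "computable (\<lambda>y. f (pfst y) (psnd y))" "computable m"
  shows "computable (\<lambda>x. \<Sum>k<m x. f k x)"
proof -
  have "rec_nat 0 (\<lambda>k r. r + f k x) n = (\<Sum>k<n. f k x)" for x n
    by (induction n) auto
  moreover have "computable (\<lambda>x. rec_nat 0 (\<lambda>k r. r + f k x) (m x))"
    by (intro computable_intros assms computable_comp2[OF assms(1)])
  ultimately show ?thesis by simp
qed

section \<open>Decidable predicates and bounded quantification\<close>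

definition decidable :: "(nat \<Rightarrow> bool) \<Rightarrow> bool" where
  "decidable P \<longleftrightarrow> computable (\<lambda>x. of_bool (P x))"

lemma computable_of_bool [computable_intros]: "decidable P \<Longrightarrow> computable (\<lambda>x. of_bool (P x))"
  by (simp add: decidable_def)

lemma decidable_not [computable_intros]:
  assumes "decidable P" shows "decidable (\<lambda>x. \<not> P x)"
proof -
  have "computable (\<lambda>x. 1 - of_bool (P x))"
    by (intro computable_intros assms)
  moreover have "(\<lambda>x. 1 - of_bool (P x)) = (\<lambda>x. of_bool (\<not> P x) :: nat)" by auto
  ultimately show ?thesis by (simp add: decidable_def)
qed

lemma decidable_conj [computable_intros]:
  assumes "decidable P" "decidable Q" shows "decidable (\<lambda>x. P x \<and> Q x)"
proof -
  have "computable (\<lambda>x. of_bool (P x) * of_bool (Q x))"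
    by (intro computable_intros assms)
  then show ?thesis by (simp add: decidable_def of_bool_conj)
qed

lemma decidable_disj [computable_intros]:
  assumes "decidable P" "decidable Q" shows "decidable (\<lambda>x. P x \<or> Q x)"
proof -
  have "decidable (\<lambda>x. \<not> (\<not> P x \<and> \<not> Q x))"
    by (intro computable_intros assms)
  then show ?thesis by simp
qed

lemma decidable_less [computable_intros]:
  assumes "computable f" "computable g" shows "decidable (\<lambda>x. f x < g x)"
proof -
  have "computable (\<lambda>x. 1 - (Suc (f x) - g x))"
    by (intro computable_intros assms)
  moreover have "1 - (Suc a - b) = of_bool (a < b)" for a b :: nat by auto
  ultimately show ?thesis by (simp add: decidable_def)
qed

lemma decidable_eq [computable_intros]:
  assumes "computable f" "computable g" shows "decidable (\<lambda>x. f x = g x)"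
proof -
  have "decidable (\<lambda>x. \<not> (f x < g x) \<and> \<not> (g x < f x))"
    by (intro computable_intros assms)
  then show ?thesis by (simp add: not_less le_antisym eq_iff conj_commute)
qed

lemma decidable_if [computable_intros]:
  assumes "decidable P" "decidable Q" "decidable R"
  shows "decidable (\<lambda>x. if P x then Q x else R x)"
proof -
  have "decidable (\<lambda>x. (P x \<and> Q x) \<or> (\<not> P x \<and> R x))"
    by (intro computable_intros assms)
  then show ?thesis by (simp add: if_bool_eq_disj)
qed

lemma computable_if [computable_intros]:
  assumes "decidable P" "computable f" "computable g"
  shows "computable (\<lambda>x. if P x then f x else g x)"
proof -
  have "computable (\<lambda>x. of_bool (P x) * f x + of_bool (\<not> P x) * g x)"
    by (intro computable_intros assms)
  moreover have "of_bool b * m + of_bool (\<not> b) * n = (if b then m else n)" for b and m n :: nat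
    by auto
  ultimately show ?thesis by simp
qed

lemma computable_mod [computable_intros]:
  assumes "computable f" "computable g" shows "computable (\<lambda>x. f x mod g x)"
proof -
  \<comment> \<open>A counter that resets on reaching \<open>n\<close>. For \<open>n = 0\<close> it
    never resets and returns \<open>m\<close>, in agreement with \<open>m mod 0 = m\<close>.\<close>
  have "rec_nat 0 (\<lambda>k r. if Suc r = n then 0 else Suc r) m = m mod n" for m n :: nat
    by (induction m) (auto simp: mod_Suc)
  moreover have "computable (\<lambda>x. rec_nat 0 (\<lambda>k r. if Suc r = g x then 0 else Suc r) (f x))"
    by (intro computable_intros assms computable_comp[OF assms(2)])
  ultimately show ?thesis by simp
qed

lemma decidable_Bex_less [computable_intros]:
  assumes "decidable (\<lambda>y. P (pfst y) (psnd y))" "computable m"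
  shows "decidable (\<lambda>x. \<exists>k<m x. P k x)"
proof -
  have "decidable (\<lambda>x. 0 < (\<Sum>k<m x. of_bool (P k x) :: nat))"
    by (intro computable_intros assms)
  moreover have "0 < (\<Sum>k<n. of_bool (P k x) :: nat) \<longleftrightarrow> (\<exists>k<n. P k x)" for n x
    by (induction n) (auto simp: less_Suc_eq)
  ultimately show ?thesis by simp
qed

lemma decidable_Ball_less [computable_intros]:
  assumes "decidable (\<lambda>y. P (pfst y) (psnd y))" "computable m"
  shows "decidable (\<lambda>x. \<forall>k<m x. P k x)"
proof -
  have "decidable (\<lambda>x. \<not> (\<exists>k<m x. \<not> P k x))"
    by (intro computable_intros assms)
  then show ?thesis by simp
qed

text \<open>Bit \<open>n\<close> of \<open>s\<close> is 1 iff the quotient of \<open>s\<close> by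
  \<open>2 ^ n\<close> is odd. A bounded search for quotient and remainder replaces the
  division.\<close>

lemma decidable_bit [computable_intros]:
  assumes "computable f" "computable g"
  shows "decidable (\<lambda>x. f x \<in> set_decode (g x))"
proof -
  have "n \<in> set_decode s \<longleftrightarrow> (\<exists>q<Suc s. \<exists>r<2 ^ n. s = (2 * q + 1) * 2 ^ n + r)" for s n :: nat
  proof
    assume "n \<in> set_decode s"
    then obtain q where q: "s div 2 ^ n = 2 * q + 1"
      unfolding set_decode_def by (auto elim: oddE)
    have s: "s = (2 * q + 1) * 2 ^ n + s mod 2 ^ n"
      unfolding q[symmetric] by (rule div_mult_mod_eq[symmetric])
    have "2 * q + 1 \<le> s"
      unfolding q[symmetric] by (rule div_le_dividend)
    then have "q < Suc s" by simp
    moreover have "s mod 2 ^ n < 2 ^ n" by simp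
    ultimately show "\<exists>q<Suc s. \<exists>r<2 ^ n. s = (2 * q + 1) * 2 ^ n + r"
      using s by blast
  next
    assume "\<exists>q<Suc s. \<exists>r<2 ^ n. s = (2 * q + 1) * 2 ^ n + r"
    then obtain q r where "r < 2 ^ n" "s = (2 * q + 1) * 2 ^ n + r" by blast
    then have "s div 2 ^ n = 2 * q + 1" by (simp only: div_mult_self3) simp
    then show "n \<in> set_decode s" by (simp add: set_decode_def)
  qed
  moreover have "decidable (\<lambda>x. \<exists>q<Suc (g x). \<exists>r<2 ^ f x. g x = (2 * q + 1) * 2 ^ f x + r)"
    by (intro computable_intros computable_comp[OF assms(1)] computable_comp[OF assms(2)] assms)
  ultimately show ?thesis by simp
qed

section \<open>Bounding quantifiers in the minimal language\<close>

text \<open>For \<open>N > 0\<close> this is equality after clamping to the interval from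
  \<open>- N\<close> to \<open>N\<close>.\<close>

definition near :: "nat \<Rightarrow> int \<Rightarrow> int \<Rightarrow> bool" where
  "near N x y \<longleftrightarrow> x = y \<or> (int N \<le> x \<and> int N \<le> y) \<or> (x \<le> - int N \<and> y \<le> - int N)"

text \<open>\<open>Q\<close> is a partial isomorphism that preserves distances only up to truncation at \<open>N\<close>.\<close>

definition matched :: "nat \<Rightarrow> nat \<Rightarrow> (int \<times> int) set \<Rightarrow> bool" where
  "matched p N Q \<longleftrightarrow> (0, 0) \<in> Q \<and>
     (\<forall>x x'. (x, x') \<in> Q \<longrightarrow> (- x, - x') \<in> Q \<and> [x = x'] (mod int p)) \<and>
     (\<forall>x x' y y'. (x, x') \<in> Q \<longrightarrow> (y, y') \<in> Q \<longrightarrow> near N (x - y) (x' - y'))"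

lemma matched_zero: "matched p N Q \<Longrightarrow> (0, 0) \<in> Q"
  and matched_uminus: "matched p N Q \<Longrightarrow> (x, x') \<in> Q \<Longrightarrow> (- x, - x') \<in> Q"
  and matched_cong: "matched p N Q \<Longrightarrow> (x, x') \<in> Q \<Longrightarrow> [x = x'] (mod int p)"
  and matched_near: "matched p N Q \<Longrightarrow> (x, x') \<in> Q \<Longrightarrow> (y, y') \<in> Q \<Longrightarrow> near N (x - y) (x' - y')"
  unfolding matched_def by blast+

lemma near_commute: "near N x y \<longleftrightarrow> near N y x"
  unfolding near_def by auto

lemma matched_converse: "matched p N Q \<Longrightarrow> matched p N (Q\<inverse>)"
  unfolding matched_def converse_iff using near_commute cong_sym by blast

lemma near_mono: "near M x y \<Longrightarrow> N \<le> M \<Longrightarrow> near N x y"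
  unfolding near_def by linarith

lemma near_uminus: "near N (- x) (- y) \<longleftrightarrow> near N x y"
  unfolding near_def by linarith

lemma near_diff_commute: "near N (x - y) (x' - y') \<longleftrightarrow> near N (y - x) (y' - x')"
  unfolding near_def by linarith

text \<open>Closure of \<open>Q\<close> under negation turns the hypothesis on \<open>n - r\<close>
  into one on \<open>n + r\<close>, and symmetry of differences gives the rest. The only new
  distance not measured against an old point is that between \<open>n\<close> and
  \<open>- n\<close>, whence the hypothesis on \<open>2 * n\<close>.\<close>

lemma matched_insert:
  assumes Q: "matched p N Q" and c: "[n = n'] (mod int p)" and two: "near N (2 * n) (2 * n')"
    and nr: "\<And>r r'. (r, r') \<in> Q \<Longrightarrow> near N (n - r) (n' - r')"
  shows "matched p N (Q \<union> {(n, n'), (- n, - n')})"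
proof -
  have a: "near N (- n - r) (- n' - r')" if "(r, r') \<in> Q" for r r'
    using nr[OF matched_uminus[OF Q that]] near_uminus[of N "n + r" "n' + r'"] by simp
  have b: "near N (r - n) (r' - n')" "near N (r - (- n)) (r' - (- n'))" if "(r, r') \<in> Q" for r r'
    using nr[OF that] a[OF that] near_diff_commute by blast+
  have d: "near N (n - (- n)) (n' - (- n'))" "near N (- n - n) (- n' - n')"
    using two near_uminus[of N "2 * n" "2 * n'"] by simp_all
  have z: "near N 0 0" by (simp add: near_def)
  show ?thesis
    unfolding matched_def
  proof (intro conjI allI impI)
    show "(0, 0) \<in> Q \<union> {(n, n'), (- n, - n')}"
      using matched_zero[OF Q] by simp
    fix x x' assume x: "(x, x') \<in> Q \<union> {(n, n'), (- n, - n')}"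
    then consider "(x, x') \<in> Q" | "x = n" "x' = n'" | "x = - n" "x' = - n'" by blast
    note x_cases = this
    then show "(- x, - x') \<in> Q \<union> {(n, n'), (- n, - n')}" "[x = x'] (mod int p)"
      using matched_uminus[OF Q] matched_cong[OF Q] c
      by (cases; simp add: cong_minus_minus_iff)+
    fix y y' assume "(y, y') \<in> Q \<union> {(n, n'), (- n, - n')}"
    then consider "(y, y') \<in> Q" | "y = n" "y' = n'" | "y = - n" "y' = - n'" by blast
    then show "near N (x - y) (x' - y')"
      using x_cases matched_near[OF Q] nr a b d z by cases (cases rule: x_cases; simp)+
  qed
qed

text \<open>
  A point close to some \<open>q\<close> keeps its distance to \<open>q\<close>. Otherwise let \<open>q\<close> be the largest point
  below \<open>n\<close>: the gap above \<open>q\<close> is long, hence so is the one above \<open>q'\<close>, and \<open>n'\<close> is placed there with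
  the right residue at distance slightly more than \<open>N\<close> from \<open>q'\<close>.
\<close>

lemma matched_extend_nonneg:
  assumes Q: "matched p M Q" and M: "3 * N + 2 * p + 1 \<le> M" and p: "p > 0" and n: "n \<ge> 0"
  shows "\<exists>n' q q'. (q, q') \<in> Q \<and> \<bar>n' - q'\<bar> \<le> int (N + p) \<and>
    matched p N (Q \<union> {(n, n'), (- n, - n')})"
proof -
  have QN: "matched p N Q"
    using Q near_mono[of M _ _ N] M unfolding matched_def by auto
  have M': "3 * int N + 2 * int p + 1 \<le> int M" using M by linarith
  have p': "int p > 0" using p by simp
  show ?thesis
  proof (cases "\<exists>(q, q') \<in> Q. \<bar>n - q\<bar> \<le> int (N + p)")
    case True
    then obtain q q' where q: "(q, q') \<in> Q" "\<bar>n - q\<bar> \<le> int (N + p)" by blast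
    define n' where "n' = q' + (n - q)"
    have "[n = n'] (mod int p)"
      using cong_add[OF matched_cong[OF Q q(1)] cong_refl[of "n - q"]] by (simp add: n'_def)
    moreover have "near N (n - r) (n' - r')" if "(r, r') \<in> Q" for r r'
      using matched_near[OF Q q(1) that] q(2) M' unfolding near_def n'_def by linarith
    \<comment> \<open>The source of the constant \<open>3 * N + 2 * p\<close>: if \<open>q\<close>
      and \<open>q'\<close> differ, comparing \<open>q\<close> with \<open>- q\<close> puts
      \<open>2 * q\<close> and \<open>2 * q'\<close> beyond \<open>M\<close> on the same side.
      Moving to \<open>2 * n\<close> loses up to \<open>2 * (N + p)\<close>, and \<open>N\<close>
      must remain.\<close>
    moreover have "near N (2 * n) (2 * n')"
    proof (cases "q = q'")
      case True
      then show ?thesis by (simp add: n'_def near_def)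
    next
      case False
      with matched_near[OF Q q(1) matched_uminus[OF Q q(1)]]
      have "(int M \<le> 2 * q \<and> int M \<le> 2 * q') \<or> (2 * q \<le> - int M \<and> 2 * q' \<le> - int M)"
        unfolding near_def by linarith
      moreover have n': "n' = q' + (n - q)" by (simp add: n'_def)
      moreover have "- (int N + int p) \<le> n - q" "n - q \<le> int N + int p"
        using q(2) by simp_all
      ultimately consider "int M \<le> 2 * q" "int M \<le> 2 * q'" | "2 * q \<le> - int M" "2 * q' \<le> - int M" by blast
      then show ?thesis
      proof cases
        case 1
        then have "int N \<le> 2 * n" "int N \<le> 2 * n'"
          using n' M' \<open>- (int N + int p) \<le> n - q\<close> by linarith+
        then show ?thesis unfolding near_def by blast
      next
        case 2
        then have "2 * n \<le> - int N" "2 * n' \<le> - int N"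
          using n' M' \<open>n - q \<le> int N + int p\<close> by linarith+
        then show ?thesis unfolding near_def by blast
      qed
    qed
    ultimately have "matched p N (Q \<union> {(n, n'), (- n, - n')})"
      by (intro matched_insert[OF QN])
    moreover have "\<bar>n' - q'\<bar> \<le> int (N + p)" using q(2) by (simp add: n'_def)
    ultimately show ?thesis using q(1) by blast
  next
    case False
    then have far: "\<bar>n - q\<bar> > int (N + p)" if "(q, q') \<in> Q" for q q'
      using that by force
    \<comment> \<open>\<open>Q\<close> may be infinite. Restricting to nonnegative points makes the
      set finite, and it still contains 0 because \<open>n \<ge> 0\<close>.\<close>
    define below where "below = {q. q \<in> fst ` Q \<and> 0 \<le> q \<and> q \<le> n}"
    have fin: "finite below" by (rule finite_subset[of _ "{0..n}"]) (auto simp: below_def)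
    have "0 \<in> below" using matched_zero[OF Q] n by (force simp: below_def)
    define q where "q = Max below"
    have "q \<in> below" unfolding q_def using fin \<open>0 \<in> below\<close> by (intro Max_in) auto
    then obtain q' where q: "(q, q') \<in> Q" "0 \<le> q" "q \<le> n" by (auto simp: below_def)
    have max: "r \<le> q" if "(r, r') \<in> Q" "r \<le> n" for r r'
    proof (cases "0 \<le> r")
      case True
      then have "r \<in> below" using that by (force simp: below_def)
      then show ?thesis unfolding q_def using fin by simp
    next
      case False
      then show ?thesis using q(2) by simp
    qed
    define j where "j = (n - q' - int N - 1) mod int p + 1"
    have j: "1 \<le> j" "j \<le> int p"
      using pos_mod_sign[OF p', of "n - q' - int N - 1"] pos_mod_bound[OF p', of "n - q' - int N - 1"]
      by (simp_all add: j_def)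
    define n' where "n' = q' + int N + j"
    have "[n' = q' + int N + ((n - q' - int N - 1) + 1)] (mod int p)"
      unfolding n'_def j_def by (intro cong_add cong_refl cong_mod_left) simp_all
    then have "[n = n'] (mod int p)" by (simp add: cong_sym)
    moreover have fq: "n - q > int N + int p" using far[OF q(1)] q(3) by simp
    moreover have "near N (n - r) (n' - r')" if r: "(r, r') \<in> Q" for r r'
    proof (cases "r \<le> n")
      case True
      from max[OF r True] fq j matched_near[OF Q q(1) r] M' show ?thesis
        unfolding near_def n'_def by linarith
    next
      case False
      \<comment> \<open>Both gaps around \<open>n\<close> exceed \<open>N + p\<close>, so
        \<open>q\<close> and \<open>r\<close> are more than \<open>2 * (N + p)\<close> apart. The
        same holds for \<open>q'\<close> and \<open>r'\<close>, by equality or by \<open>M\<close>.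
        As \<open>n'\<close> uses at most \<open>N + p\<close> of this gap, enough is left below
        \<open>r'\<close>.\<close>
      with far[OF r] have "r - n > int N + int p" by simp
      with fq j matched_near[OF Q r q(1)] M' show ?thesis
        unfolding near_def n'_def by linarith
    qed
    moreover have "near N (2 * n) (2 * n')"
    proof -
      have "0 \<le> q'"
        using matched_near[OF Q q(1) matched_zero[OF Q]] q(2) M' unfolding near_def by linarith
      then have "int N \<le> 2 * n" "int N \<le> 2 * n'"
        using q(2) fq j by (simp_all add: n'_def)
      then show ?thesis unfolding near_def by blast
    qed
    ultimately have "matched p N (Q \<union> {(n, n'), (- n, - n')})"
      by (intro matched_insert[OF QN])
    moreover have "\<bar>n' - q'\<bar> \<le> int (N + p)" using j by (simp add: n'_def)
    ultimately show ?thesis using q(1) by blast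
  qed
qed

text \<open>A negative \<open>n\<close> is handled by reflection: extending by \<open>- n\<close>
  adds the same two points.\<close>

lemma matched_extend:
  assumes Q: "matched p M Q" and M: "3 * N + 2 * p + 1 \<le> M" and p: "p > 0"
  shows "\<exists>n' q q'. (q, q') \<in> Q \<and> \<bar>n' - q'\<bar> \<le> int (N + p) \<and>
    matched p N (Q \<union> {(n, n'), (- n, - n')})"
proof (cases "n \<ge> 0")
  case True
  then show ?thesis by (rule matched_extend_nonneg[OF assms])
next
  case False
  then have "- n \<ge> 0" by simp
  from matched_extend_nonneg[OF assms this] obtain n' q q' where
    *: "(q, q') \<in> Q" "\<bar>n' - q'\<bar> \<le> int (N + p)" "matched p N (Q \<union> {(- n, n'), (n, - n')})" by auto
  show ?thesis
  proof (intro exI conjI)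
    show "(- q, - q') \<in> Q" by (rule matched_uminus[OF Q *(1)])
    show "\<bar>- n' - (- q')\<bar> \<le> int (N + p)" using *(2) by linarith
    show "matched p N (Q \<union> {(n, - n'), (- n, - (- n'))})" using *(3) by (simp add: insert_commute)
  qed
qed

section \<open>Back-and-forth for formulas of the minimal language\<close>

primrec tm_const :: "tm \<Rightarrow> nat" where
  "tm_const (Var i) = 0"
| "tm_const (Num n) = n"
| "tm_const (Neg t) = tm_const t"
| "tm_const (Add s t) = tm_const s + tm_const t"
| "tm_const (Mul s t) = tm_const s + tm_const t"

text \<open>The quantifier clause is the loss in \<open>matched_extend\<close>. At an order or
  equality atom the \<open>+ 1\<close> makes the radius exceed \<open>\<bar>d - c\<bar>\<close> for
  the numeral offsets \<open>c\<close>, \<open>d\<close> of the two terms, so truncation cannot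
  affect the comparison of \<open>q + c\<close> with \<open>r + d\<close>. Residues are preserved
  exactly and need no radius.\<close>

primrec radius :: "nat \<Rightarrow> fm \<Rightarrow> nat" where
  "radius p (Less s t) = tm_const s + tm_const t + 1"
| "radius p (Eq s t) = tm_const s + tm_const t + 1"
| "radius p (Rel a t) = 0"
| "radius p (FNot \<phi>) = radius p \<phi>"
| "radius p (FAnd \<phi> \<psi>) = max (radius p \<phi>) (radius p \<psi>)"
| "radius p (FOr \<phi> \<psi>) = max (radius p \<phi>) (radius p \<psi>)"
| "radius p (FEx \<phi>) = 3 * radius p \<phi> + 2 * p + 1"
| "radius p (FAll \<phi>) = 3 * radius p \<phi> + 2 * p + 1"

text \<open>A minimal term is a variable or a numeral under negations: either a point of
  \<open>Q\<close> without offset, or the point 0 with an offset common to both sides.\<close>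

lemma matched_tm_val:
  assumes Q: "matched p N Q" and "min_tm t" and e: "\<And>i. (e i, e' i) \<in> Q"
  shows "\<exists>q q' c. (q, q') \<in> Q \<and> tm_val e t = q + c \<and> tm_val e' t = q' + c \<and> \<bar>c\<bar> \<le> int (tm_const t)"
  using assms(2)
proof (induction t)
  case (Var i)
  show ?case by (rule exI[of _ "e i"], rule exI[of _ "e' i"], rule exI[of _ 0]) (simp add: e)
next
  case (Num n)
  show ?case by (rule exI[of _ 0], rule exI[of _ 0], rule exI[of _ "int n"]) (simp add: matched_zero[OF Q])
next
  case (Neg t)
  then obtain q q' c where "(q, q') \<in> Q" "tm_val e t = q + c" "tm_val e' t = q' + c" "\<bar>c\<bar> \<le> int (tm_const t)"
    by auto
  then show ?case
    by (intro exI[of _ "- q"] exI[of _ "- q'"] exI[of _ "- c"]) (simp add: matched_uminus[OF Q])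
qed simp_all

text \<open>At a quantifier, \<open>matched_extend\<close> finds a partner for the witness while the
  radius drops to that of the body. The local fact \<open>imp\<close> is one direction for an
  arbitrary relation; applied to \<open>Q\<close> and to its converse it gives both.\<close>

lemma sat_matched:
  assumes p: "p > 0" and "\<phi> \<in> Lp_min p" "matched p N Q" "radius p \<phi> \<le> N" "\<And>i. (e i, e' i) \<in> Q"
  shows "sat p e \<phi> \<longleftrightarrow> sat p e' \<phi>"
  using assms(2-5)
proof (induction \<phi> arbitrary: N Q e e' rule: Lp_min.induct)
  case (1 s t)
  obtain q q' c where s: "(q, q') \<in> Q" "tm_val e s = q + c" "tm_val e' s = q' + c" "\<bar>c\<bar> \<le> int (tm_const s)"
    using matched_tm_val[of p N Q s e e'] 1 by blast
  obtain r r' d where t: "(r, r') \<in> Q" "tm_val e t = r + d" "tm_val e' t = r' + d" "\<bar>d\<bar> \<le> int (tm_const t)"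
    using matched_tm_val[of p N Q t e e'] 1 by blast
  have "int (tm_const s) + int (tm_const t) + 1 \<le> int N" using 1 by simp
  with s t matched_near[OF 1(3) s(1) t(1)] show ?case
    unfolding near_def sat.simps by linarith
next
  case (2 s t)
  obtain q q' c where s: "(q, q') \<in> Q" "tm_val e s = q + c" "tm_val e' s = q' + c" "\<bar>c\<bar> \<le> int (tm_const s)"
    using matched_tm_val[of p N Q s e e'] 2 by blast
  obtain r r' d where t: "(r, r') \<in> Q" "tm_val e t = r + d" "tm_val e' t = r' + d" "\<bar>d\<bar> \<le> int (tm_const t)"
    using matched_tm_val[of p N Q t e e'] 2 by blast
  have "int (tm_const s) + int (tm_const t) + 1 \<le> int N" using 2 by simp
  with s t matched_near[OF 2(3) s(1) t(1)] show ?case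
    unfolding near_def sat.simps by linarith
next
  case (3 a t)
  obtain q q' c where t: "(q, q') \<in> Q" "tm_val e t = q + c" "tm_val e' t = q' + c"
    using matched_tm_val[of p N Q t e e'] 3 by blast
  have "[tm_val e t = tm_val e' t] (mod int p)"
    unfolding t using matched_cong[OF 3(3) t(1)] by (intro cong_add cong_refl)
  then show ?case by (auto intro: cong_trans cong_sym)
next
  case (7 \<phi>)
  have imp: "sat p f' (FEx \<phi>)"
    if P: "matched p N P" and f: "\<And>i. (f i, f' i) \<in> P" and "sat p f (FEx \<phi>)" for P f f'
  proof -
    from that obtain n where n: "sat p (case_nat n f) \<phi>" by auto
    from 7 have "3 * radius p \<phi> + 2 * p + 1 \<le> N" by simp
    from matched_extend[OF P this p, of n] obtain n' where
      n': "matched p (radius p \<phi>) (P \<union> {(n, n'), (- n, - n')})" by blast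
    have "sat p (case_nat n f) \<phi> \<longleftrightarrow> sat p (case_nat n' f') \<phi>"
      by (rule 7(2)[OF n']) (auto split: nat.split simp: f)
    with n show ?thesis by auto
  qed
  show ?case
    using imp[of Q e e'] imp[of "Q\<inverse>" e' e] matched_converse[OF 7(3)] 7(3,5) by auto
next
  case (8 \<phi>)
  have imp: "sat p f' (FEx (FNot \<phi>))"
    if P: "matched p N P" and f: "\<And>i. (f i, f' i) \<in> P" and "sat p f (FEx (FNot \<phi>))" for P f f'
  proof -
    from that obtain n where n: "\<not> sat p (case_nat n f) \<phi>" by auto
    from 8 have "3 * radius p \<phi> + 2 * p + 1 \<le> N" by simp
    from matched_extend[OF P this p, of n] obtain n' where
      n': "matched p (radius p \<phi>) (P \<union> {(n, n'), (- n, - n')})" by blast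
    have "sat p (case_nat n f) \<phi> \<longleftrightarrow> sat p (case_nat n' f') \<phi>"
      by (rule 8(2)[OF n']) (auto split: nat.split simp: f)
    with n show ?thesis by auto
  qed
  show ?case
    using imp[of Q e e'] imp[of "Q\<inverse>" e' e] matched_converse[OF 8(3)] 8(3,5) by auto
next
  case (4 \<phi>)
  have "sat p e \<phi> \<longleftrightarrow> sat p e' \<phi>" by (rule 4(2)) (use 4 in auto)
  then show ?case by simp
next
  case (5 \<phi> \<psi>)
  have "sat p e \<phi> \<longleftrightarrow> sat p e' \<phi>" by (rule 5(3)[OF 5(5)]) (use 5 in auto)
  moreover have "sat p e \<psi> \<longleftrightarrow> sat p e' \<psi>" by (rule 5(4)[OF 5(5)]) (use 5 in auto)
  ultimately show ?case by simp
next
  case (6 \<phi> \<psi>)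
  have "sat p e \<phi> \<longleftrightarrow> sat p e' \<phi>" by (rule 6(3)[OF 6(5)]) (use 6 in auto)
  moreover have "sat p e \<psi> \<longleftrightarrow> sat p e' \<psi>" by (rule 6(4)[OF 6(5)]) (use 6 in auto)
  ultimately show ?case by simp
qed

text \<open>Extend the identity on \<open>{-B..B}\<close>, which is matched for every radius.\<close>

lemma sat_FEx_bounded:
  assumes p: "p > 0" and \<phi>: "\<phi> \<in> Lp_min p" and e: "\<And>i. \<bar>e i\<bar> \<le> B" and N: "radius p \<phi> \<le> N"
  shows "sat p e (FEx \<phi>) \<longleftrightarrow> (\<exists>n. \<bar>n\<bar> \<le> B + int (N + p) \<and> sat p (case_nat n e) \<phi>)"
proof
  assume "sat p e (FEx \<phi>)"
  then obtain n where n: "sat p (case_nat n e) \<phi>" by auto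
  have "0 \<le> B" using e[of 0] by linarith
  then have Q: "matched p (3 * N + 2 * p + 1) {(q, q) | q. \<bar>q\<bar> \<le> B}"
    unfolding matched_def by (auto simp: near_def)
  from matched_extend[OF this order_refl p, of n] obtain n' q where
    n': "\<bar>q\<bar> \<le> B" "\<bar>n' - q\<bar> \<le> int (N + p)"
      "matched p N ({(q, q) | q. \<bar>q\<bar> \<le> B} \<union> {(n, n'), (- n, - n')})" by blast
  have "sat p (case_nat n e) \<phi> \<longleftrightarrow> sat p (case_nat n' e) \<phi>"
    by (rule sat_matched[OF p \<phi> n'(3) N]) (auto split: nat.split simp: e)
  moreover have "\<bar>n'\<bar> \<le> B + int (N + p)" using n'(1,2) by linarith
  ultimately show "\<exists>n. \<bar>n\<bar> \<le> B + int (N + p) \<and> sat p (case_nat n e) \<phi>" using n by blast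
qed auto

section \<open>Translation of the coarse interpretation into the minimal language\<close>

definition eq_fm :: "nat \<Rightarrow> (nat \<Rightarrow> nat \<Rightarrow> nat) \<Rightarrow> fm \<Rightarrow> nat \<Rightarrow> nat \<Rightarrow> nat \<Rightarrow> fm" where
  "eq_fm p f \<alpha> x y z = FAnd (residues_fm p f x y z) (inst3 \<alpha> x y z)"

definition less_fm :: "nat \<Rightarrow> (nat \<Rightarrow> nat \<Rightarrow> nat) \<Rightarrow> fm \<Rightarrow> nat \<Rightarrow> nat \<Rightarrow> nat \<Rightarrow> fm" where
  "less_fm p f \<alpha> x y z = FEx (FAnd (eq_fm p f \<alpha> (Suc x) (Suc y) 0) (Less (Var 0) (Var (Suc z))))"

primrec coarse_fm :: "nat \<Rightarrow> fm \<Rightarrow> fm \<Rightarrow> fm \<Rightarrow> fm" where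
  "coarse_fm p \<sigma> \<pi> (Eq s t) =
     (case (s, t) of
        (Add (Var x) (Var y), Var z) \<Rightarrow> eq_fm p (+) \<sigma> x y z
      | (Mul (Var x) (Var y), Var z) \<Rightarrow> eq_fm p (*) \<pi> x y z
      | _ \<Rightarrow> Eq s t)"
| "coarse_fm p \<sigma> \<pi> (Less s t) =
     (case (s, t) of
        (Add (Var x) (Var y), Var z) \<Rightarrow> less_fm p (+) \<sigma> x y z
      | (Mul (Var x) (Var y), Var z) \<Rightarrow> less_fm p (*) \<pi> x y z
      | _ \<Rightarrow> Less s t)"
| "coarse_fm p \<sigma> \<pi> (Rel a t) = Rel a t"
| "coarse_fm p \<sigma> \<pi> (FNot \<phi>) = FNot (coarse_fm p \<sigma> \<pi> \<phi>)"
| "coarse_fm p \<sigma> \<pi> (FAnd \<phi> \<psi>) = FAnd (coarse_fm p \<sigma> \<pi> \<phi>) (coarse_fm p \<sigma> \<pi> \<psi>)"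
| "coarse_fm p \<sigma> \<pi> (FOr \<phi> \<psi>) = FOr (coarse_fm p \<sigma> \<pi> \<phi>) (coarse_fm p \<sigma> \<pi> \<psi>)"
| "coarse_fm p \<sigma> \<pi> (FEx \<phi>) = FEx (coarse_fm p \<sigma> \<pi> \<phi>)"
| "coarse_fm p \<sigma> \<pi> (FAll \<phi>) = FAll (coarse_fm p \<sigma> \<pi> \<phi>)"

lemma coarse_fm_min_tm:
  assumes "min_tm s"
  shows "coarse_fm p \<sigma> \<pi> (Eq s t) = Eq s t" "coarse_fm p \<sigma> \<pi> (Less s t) = Less s t"
    "coarse_basic p \<sigma> \<pi> (Eq s t) = cls p (Eq s t)" "coarse_basic p \<sigma> \<pi> (Less s t) = cls p (Less s t)"
  using assms by (cases s; simp)+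

lemma Lp_min_subset_Lp: "Lp_min p \<subseteq> Lp p"
proof
  show "\<phi> \<in> Lp p" if "\<phi> \<in> Lp_min p" for \<phi>
    using that by induction (auto intro: Lp.intros)
qed

lemma min_tm_rename [simp]: "min_tm (tm_rename f t) \<longleftrightarrow> min_tm t"
  by (induction t) auto

lemma rename_Lp_min: "\<phi> \<in> Lp_min p \<Longrightarrow> rename f \<phi> \<in> Lp_min p"
  by (induction \<phi> arbitrary: f rule: Lp_min.induct) (auto intro: Lp_min.intros)

lemma tm_val_rename [simp]: "tm_val e (tm_rename f t) = tm_val (\<lambda>i. e (f i)) t"
  by (induction t) auto

lemma sat_rename [simp]: "sat p e (rename f \<phi>) \<longleftrightarrow> sat p (\<lambda>i. e (f i)) \<phi>"
proof (induction \<phi> arbitrary: e f)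
  have *: "(\<lambda>i. case_nat n e (case_nat 0 (\<lambda>i. Suc (f i)) i)) = case_nat n (\<lambda>i. e (f i))"
    for n :: int and e :: "nat \<Rightarrow> int" and f
    by (auto split: nat.split)
  case (FEx \<phi>)
  show ?case by (simp add: FEx *)
next
  have *: "(\<lambda>i. case_nat n e (case_nat 0 (\<lambda>i. Suc (f i)) i)) = case_nat n (\<lambda>i. e (f i))"
    for n :: int and e :: "nat \<Rightarrow> int" and f
    by (auto split: nat.split)
  case (FAll \<phi>)
  show ?case by (simp add: FAll *)
qed simp_all

lemma tm_const_rename [simp]: "tm_const (tm_rename f t) = tm_const t"
  by (induction t) auto

lemma radius_rename [simp]: "radius p (rename f \<phi>) = radius p \<phi>"
  by (induction \<phi> arbitrary: f) auto

lemma residues_fm_Lp_min: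
  assumes "p > 0" shows "residues_fm p f x y z \<in> Lp_min p"
proof -
  have *: "disj \<phi>s \<in> Lp_min p" if "set \<phi>s \<subseteq> Lp_min p" for \<phi>s
    using that by (induction \<phi>s) (auto simp: disj_def intro: Lp_min.intros)
  then show ?thesis
    unfolding residues_fm_def using assms by (intro *) (auto intro!: Lp_min.intros)
qed

lemma sat_residues_fm:
  "sat p e (residues_fm p f x y z) \<longleftrightarrow>
    (\<exists>a<p. \<exists>b<p. [e x = int a] (mod int p) \<and> [e y = int b] (mod int p) \<and> [e z = int (f a b mod p)] (mod int p))"
proof -
  have *: "sat p e (disj \<phi>s) \<longleftrightarrow> (\<exists>\<phi>\<in>set \<phi>s. sat p e \<phi>)" for \<phi>s
    by (induction \<phi>s) (auto simp: disj_def)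
  show ?thesis unfolding residues_fm_def * by (simp add: atLeast0LessThan) blast
qed

lemma radius_residues_fm: "radius p (residues_fm p f x y z) \<le> 1"
proof -
  \<comment> \<open>The 1 is the radius of the false atom that terminates \<open>disj\<close>; the
    residue atoms contribute 0.\<close>
  have *: "radius p (disj \<phi>s) \<le> 1" if "\<forall>\<phi>\<in>set \<phi>s. radius p \<phi> = 0" for \<phi>s
    using that by (induction \<phi>s) (auto simp: disj_def)
  show ?thesis unfolding residues_fm_def by (rule *) auto
qed

lemma eq_fm_Lp_min: "p > 0 \<Longrightarrow> \<alpha> \<in> Lp_min p \<Longrightarrow> eq_fm p f \<alpha> x y z \<in> Lp_min p"
  unfolding eq_fm_def inst3_def by (intro Lp_min.intros rename_Lp_min residues_fm_Lp_min)

lemma less_fm_Lp_min: "p > 0 \<Longrightarrow> \<alpha> \<in> Lp_min p \<Longrightarrow> less_fm p f \<alpha> x y z \<in> Lp_min p"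
  unfolding less_fm_def by (intro Lp_min.intros eq_fm_Lp_min) auto

lemma coarse_fm_Lp_min:
  assumes p: "p > 0" and \<sigma>: "\<sigma> \<in> Lp_min p" and \<pi>: "\<pi> \<in> Lp_min p" and "\<psi> \<in> basic p"
  shows "coarse_fm p \<sigma> \<pi> \<psi> \<in> Lp_min p"
  using assms(4)
proof induction
  case (1 s t)
  then show ?case by (simp only: coarse_fm_min_tm Lp_min.intros)
next
  case (2 s t)
  then show ?case by (simp only: coarse_fm_min_tm Lp_min.intros)
qed (auto intro: Lp_min.intros simp: eq_fm_Lp_min[OF p \<sigma>] eq_fm_Lp_min[OF p \<pi>]
    less_fm_Lp_min[OF p \<sigma>] less_fm_Lp_min[OF p \<pi>])

definition triple :: "int \<Rightarrow> int \<Rightarrow> int \<Rightarrow> nat \<Rightarrow> int" where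
  "triple a b c = case_nat a (case_nat b (case_nat c (\<lambda>_. 0)))"

lemma triple_simps [simp]: "triple a b c 0 = a" "triple a b c 1 = b" "triple a b c 2 = c"
  by (simp_all add: triple_def numeral_2_eq_2)

lemma sat_inst3:
  "sat p e (inst3 \<alpha> x y z) \<longleftrightarrow> sat p (\<lambda>i. if i = 0 then e x else if i = 1 then e y else e z) \<alpha>"
proof -
  have "(\<lambda>i :: nat. e (if i = 0 then x else if i = 1 then y else z)) =
      (\<lambda>i. if i = 0 then e x else if i = 1 then e y else e z)"
    by auto
  then show ?thesis by (simp only: inst3_def sat_rename)
qed

text \<open>Reduces an atom at arbitrary variables to one fixed formula evaluated at three integers,
  so that a single algorithm serves all \<open>x\<close>, \<open>y\<close>,
  \<open>z\<close>.\<close>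

lemma sat_eq_fm: "sat p e (eq_fm p f \<alpha> x y z) \<longleftrightarrow> sat p (triple (e x) (e y) (e z)) (eq_fm p f \<alpha> 0 1 2)"
  unfolding eq_fm_def sat.simps sat_residues_fm sat_inst3 triple_simps ..

lemma sat_less_fm:
  "sat p e (less_fm p f \<alpha> x y z) \<longleftrightarrow> sat p (triple (e x) (e y) (e z)) (less_fm p f \<alpha> 0 1 2)"
proof -
  have "sat p e (less_fm p f \<alpha> x y z) \<longleftrightarrow>
    (\<exists>n. sat p (triple (e x) (e y) n) (eq_fm p f \<alpha> 0 1 2) \<and> n < e z)" for e x y z
    unfolding less_fm_def sat.simps sat_eq_fm[of _ _ _ _ "Suc x"] by simp
  from this[of e x y z] this[of "triple (e x) (e y) (e z)" 0 1 2] show ?thesis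
    by (simp only: triple_simps)
qed

section \<open>Representatives of Lindenbaum classes\<close>

lemma cls_eq: "\<phi> \<in> Lp p \<Longrightarrow> cls p \<phi> = {\<psi> \<in> Lp p. \<forall>e. sat p e \<phi> \<longleftrightarrow> sat p e \<psi>}"
  unfolding cls_def lind_rel_def Z_def by (auto intro: Lp.intros)

text \<open>All members of the class give the same class under \<open>F\<close>, so the union in
  \<open>induced1\<close> collapses. In \<open>resp\<close> the equivalence is assumed in every
  environment, because \<open>F\<close> may be a quantifier and change the environment.\<close>

lemma induced1_cls:
  assumes \<phi>: "\<phi> \<in> Lp p" and F: "\<And>\<psi>. \<psi> \<in> Lp p \<Longrightarrow> F \<psi> \<in> Lp p"
    and resp: "\<And>\<psi> e. (\<forall>e. sat p e \<phi> \<longleftrightarrow> sat p e \<psi>) \<Longrightarrow> sat p e (F \<phi>) \<longleftrightarrow> sat p e (F \<psi>)"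
  shows "induced1 p F (cls p \<phi>) = cls p (F \<phi>)"
proof -
  have "cls p (F \<psi>) = cls p (F \<phi>)" if "\<psi> \<in> cls p \<phi>" for \<psi>
    using that \<phi> F[of \<psi>] F[of \<phi>] resp[of \<psi>] by (simp add: cls_eq)
  moreover have "\<phi> \<in> cls p \<phi>" using \<phi> by (simp add: cls_eq)
  ultimately show ?thesis unfolding induced1_def by blast
qed

lemma induced2_cls:
  assumes \<phi>: "\<phi> \<in> Lp p" "\<psi> \<in> Lp p" and F: "\<And>\<phi> \<psi>. \<phi> \<in> Lp p \<Longrightarrow> \<psi> \<in> Lp p \<Longrightarrow> F \<phi> \<psi> \<in> Lp p"
    and resp: "\<And>\<phi>' \<psi>' e. (\<forall>e. sat p e \<phi> \<longleftrightarrow> sat p e \<phi>') \<Longrightarrow> (\<forall>e. sat p e \<psi> \<longleftrightarrow> sat p e \<psi>') \<Longrightarrow>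
      sat p e (F \<phi> \<psi>) \<longleftrightarrow> sat p e (F \<phi>' \<psi>')"
  shows "induced2 p F (cls p \<phi>) (cls p \<psi>) = cls p (F \<phi> \<psi>)"
proof -
  have "cls p (F \<phi>' \<psi>') = cls p (F \<phi> \<psi>)" if "\<phi>' \<in> cls p \<phi>" "\<psi>' \<in> cls p \<psi>" for \<phi>' \<psi>'
    using that \<phi> F[of \<phi> \<psi>] F[of \<phi>' \<psi>'] resp[of \<phi>' \<psi>'] by (simp add: cls_eq)
  moreover have "\<phi> \<in> cls p \<phi>" "\<psi> \<in> cls p \<psi>" using \<phi> by (simp_all add: cls_eq)
  ultimately show ?thesis unfolding induced2_def by blast
qed

lemma induced_connectives:
  assumes "\<phi> \<in> Lp p"
  shows "induced1 p FNot (cls p \<phi>) = cls p (FNot \<phi>)"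
    and "induced1 p FEx (cls p \<phi>) = cls p (FEx \<phi>)"
    and "induced1 p FAll (cls p \<phi>) = cls p (FAll \<phi>)"
    and "\<psi> \<in> Lp p \<Longrightarrow> induced2 p FAnd (cls p \<phi>) (cls p \<psi>) = cls p (FAnd \<phi> \<psi>)"
    and "\<psi> \<in> Lp p \<Longrightarrow> induced2 p FOr (cls p \<phi>) (cls p \<psi>) = cls p (FOr \<phi> \<psi>)"
  by (rule induced1_cls induced2_cls; use assms in \<open>auto intro: Lp.intros\<close>)+

lemma coarse_eq_cls:
  assumes p: "p > 0" and \<alpha>: "\<alpha> \<in> Lp_min p"
  shows "coarse_eq p f \<alpha> x y z = cls p (eq_fm p f \<alpha> x y z)"
  unfolding coarse_eq_def eq_fm_def inst3_def
  using residues_fm_Lp_min[OF p] rename_Lp_min[OF \<alpha>] Lp_min_subset_Lp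
  by (intro induced_connectives) blast+

lemma coarse_less_cls:
  assumes p: "p > 0" and \<alpha>: "\<alpha> \<in> Lp_min p"
  shows "coarse_less p f \<alpha> x y z = cls p (less_fm p f \<alpha> x y z)"
proof -
  let ?E = "eq_fm p f \<alpha> (Suc x) (Suc y) 0" and ?L = "Less (Var 0) (Var (Suc z))"
  have E: "?E \<in> Lp p" using eq_fm_Lp_min[OF p \<alpha>] Lp_min_subset_Lp by blast
  have L: "?L \<in> Lp p" by (rule Lp.intros)
  show ?thesis
    unfolding coarse_less_def less_fm_def coarse_eq_cls[OF assms]
    using E L by (simp add: induced_connectives Lp.intros)
qed

lemma coarse_basic_cls:
  assumes p: "p > 0" and \<sigma>: "\<sigma> \<in> Lp_min p" and \<pi>: "\<pi> \<in> Lp_min p" and "\<psi> \<in> basic p"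
  shows "coarse_basic p \<sigma> \<pi> \<psi> = cls p (coarse_fm p \<sigma> \<pi> \<psi>)"
  using assms(4)
proof induction
  case (1 s t)
  then show ?case by (simp only: coarse_fm_min_tm)
next
  case (2 s t)
  then show ?case by (simp only: coarse_fm_min_tm)
qed (simp_all add: coarse_eq_cls[OF p \<sigma>] coarse_eq_cls[OF p \<pi>] coarse_less_cls[OF p \<sigma>]
    coarse_less_cls[OF p \<pi>] induced_connectives coarse_fm_Lp_min[OF p \<sigma> \<pi>, THEN subsetD[OF Lp_min_subset_Lp]])

lemma cls_eq_lind_bot_iff: "\<phi> \<in> Lp p \<Longrightarrow> cls p \<phi> = lind_bot p \<longleftrightarrow> \<not> (\<exists>e. sat p e \<phi>)"
  by (auto simp: cls_eq lind_bot_def)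

lemma tm_const_le_code: "tm_const t \<le> code_tm t"
proof (induction t)
  case (Neg t)
  then show ?case using add_le_prod_encode[of 2 "code_tm t"] by simp
next
  case (Add s t)
  then show ?case
    using add_le_prod_encode[of "code_tm s" "code_tm t"]
      add_le_prod_encode[of 3 "prod_encode (code_tm s, code_tm t)"] by simp
next
  case (Mul s t)
  then show ?case
    using add_le_prod_encode[of "code_tm s" "code_tm t"]
      add_le_prod_encode[of 4 "prod_encode (code_tm s, code_tm t)"] by simp
next
  case (Num n)
  then show ?case using add_le_prod_encode[of 1 n] by simp
qed simp_all

section \<open>Evaluation of formulas on codes\<close>

text \<open>
  The pair \<open>(a, b)\<close> codes the integer \<open>a - b\<close>; codes are not unique, but negation is a swap.
  Environments are nested pairs, so binding a variable is pairing, and \<open>0\<close> codes the zero environment.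
\<close>

definition decode_int :: "nat \<Rightarrow> int" where
  "decode_int z = int (pfst z) - int (psnd z)"

definition lookup :: "nat \<Rightarrow> nat \<Rightarrow> nat" where
  "lookup e i = pfst ((psnd ^^ i) e)"

definition env :: "nat \<Rightarrow> nat \<Rightarrow> int" where
  "env e i = decode_int (lookup e i)"

lemma env_prod_encode: "env (prod_encode (m, e)) = case_nat (decode_int m) (env e)"
  by (rule ext) (auto simp: env_def lookup_def funpow_swap1[symmetric] funpow_Suc_right simp del: funpow.simps split: nat.split)

lemma abs_decode_int_le: "\<bar>decode_int z\<bar> \<le> int z"
  using pfst_plus_psnd_le[of z] by (simp add: decode_int_def)

text \<open>Projections never exceed the code, so the code of an environment itself can serve as the
  bound on its values.\<close>

lemma abs_env_le: "\<bar>env e i\<bar> \<le> int e"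
proof -
  have le: "pfst z \<le> z" "psnd z \<le> z" for z
    using pfst_plus_psnd_le[of z] by linarith+
  have "(psnd ^^ i) e \<le> e"
    by (induction i) (auto intro: order_trans le)
  then have "lookup e i \<le> e"
    unfolding lookup_def by (rule order_trans[OF le(1)])
  then show ?thesis
    unfolding env_def using abs_decode_int_le[of "lookup e i"] by linarith
qed

lemma env_0: "env 0 = (\<lambda>_. 0)"
  using abs_env_le[of 0] by auto

lemma decode_int_surj:
  assumes "\<bar>n\<bar> \<le> int B" obtains m where "m < Suc (prod_encode (B, B))" "decode_int m = n"
proof
  show "prod_encode (nat n, nat (- n)) < Suc (prod_encode (B, B))"
    using assms by (intro le_imp_less_Suc prod_encode_mono) linarith+
  show "decode_int (prod_encode (nat n, nat (- n))) = n"
    by (simp add: decode_int_def)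
qed

text \<open>Every integer of absolute value at most \<open>e + (N + p)\<close> has a code in the
  range searched. Codes of other integers in that range do no harm, as each yields a genuine
  witness.\<close>

lemma sat_env_FEx:
  assumes p: "p > 0" and \<phi>: "\<phi> \<in> Lp_min p" and N: "radius p \<phi> \<le> N"
  shows "sat p (env e) (FEx \<phi>) \<longleftrightarrow>
    (\<exists>m<Suc (prod_encode (e + (N + p), e + (N + p))). sat p (env (prod_encode (m, e))) \<phi>)"
proof
  assume "sat p (env e) (FEx \<phi>)"
  then obtain n where n: "\<bar>n\<bar> \<le> int e + int (N + p)" "sat p (case_nat n (env e)) \<phi>"
    using sat_FEx_bounded[of p \<phi> "env e" "int e" N] p \<phi> N abs_env_le by blast
  then have "\<bar>n\<bar> \<le> int (e + (N + p))" by simp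
  from decode_int_surj[OF this] n(2)
  show "\<exists>m<Suc (prod_encode (e + (N + p), e + (N + p))). sat p (env (prod_encode (m, e))) \<phi>"
    unfolding env_prod_encode by metis
qed (auto simp: env_prod_encode)

lemma sat_env_FAll:
  assumes "p > 0" and "\<phi> \<in> Lp_min p" and "radius p \<phi> \<le> N"
  shows "sat p (env e) (FAll \<phi>) \<longleftrightarrow>
    (\<forall>m<Suc (prod_encode (e + (N + p), e + (N + p))). sat p (env (prod_encode (m, e))) \<phi>)"
  using sat_env_FEx[of p "FNot \<phi>" N e] assms by (auto intro: Lp_min.intros)

text \<open>The state is the parity of the negations removed so far, paired with the code of the remaining term.\<close>

definition strip_neg :: "nat \<Rightarrow> nat" where
  "strip_neg r = (if pfst (psnd r) = 2 then prod_encode (1 - pfst r, psnd (psnd r)) else r)"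

definition signed_value :: "nat \<Rightarrow> nat \<Rightarrow> nat" where
  "signed_value r e =
     (let v = if pfst (psnd r) = 0 then lookup e (psnd (psnd r)) else prod_encode (psnd (psnd r), 0)
      in if pfst r = 0 then v else prod_encode (psnd v, pfst v))"

text \<open>The code of a term is at least its number of leading negations, and
  \<open>strip_neg\<close> fixes a term without one, so \<open>t\<close> iterations suffice.\<close>

definition eval_tm :: "nat \<Rightarrow> nat \<Rightarrow> nat" where
  "eval_tm t e = signed_value ((strip_neg ^^ t) (prod_encode (0, t))) e"

text \<open>The induction needs either parity and any sufficient number of steps: removing a
  negation uses one step, lowers the code and flips the parity.\<close>

lemma decode_int_signed_value:
  assumes "min_tm t" "code_tm t \<le> k" "s \<le> 1"
  shows "decode_int (signed_value ((strip_neg ^^ k) (prod_encode (s, code_tm t))) e) =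
    (if s = 0 then tm_val (env e) t else - tm_val (env e) t)"
  using assms
proof (induction t arbitrary: k s)
  case (Var i)
  have "strip_neg (prod_encode (s, code_tm (Var i))) = prod_encode (s, code_tm (Var i))"
    by (simp add: strip_neg_def)
  then have "(strip_neg ^^ k) (prod_encode (s, code_tm (Var i))) = prod_encode (s, code_tm (Var i))"
    by (induction k) simp_all
  then show ?case by (simp add: signed_value_def env_def decode_int_def Let_def)
next
  case (Num n)
  have "strip_neg (prod_encode (s, code_tm (Num n))) = prod_encode (s, code_tm (Num n))"
    by (simp add: strip_neg_def)
  then have "(strip_neg ^^ k) (prod_encode (s, code_tm (Num n))) = prod_encode (s, code_tm (Num n))"
    by (induction k) simp_all
  then show ?case by (simp add: signed_value_def decode_int_def)
next
  case (Neg t)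
  have "code_tm t < k"
    using prod_encode_less[of 2 "code_tm t"] Neg.prems(2) by simp
  then obtain k' where k: "k = Suc k'" "code_tm t \<le> k'" by (cases k) auto
  have "(strip_neg ^^ k) (prod_encode (s, code_tm (Neg t))) =
      (strip_neg ^^ k') (prod_encode (1 - s, code_tm t))"
    by (simp add: k funpow_swap1 strip_neg_def)
  with Neg.IH[OF _ k(2), of "1 - s"] Neg.prems show ?case by auto
qed simp_all

lemma decode_int_eval_tm: "min_tm t \<Longrightarrow> decode_int (eval_tm (code_tm t) e) = tm_val (env e) t"
  unfolding eval_tm_def by (simp add: decode_int_signed_value)

lemma computable_lookup [computable_intros]:
  assumes "computable f" "computable g" shows "computable (\<lambda>x. lookup (f x) (g x))"
  unfolding lookup_def by (intro computable_intros computable_funpow[of "\<lambda>r x. psnd r"] assms)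

lemma computable_eval_tm [computable_intros]:
  assumes "computable f" "computable g" shows "computable (\<lambda>x. eval_tm (f x) (g x))"
  unfolding eval_tm_def signed_value_def Let_def
  by (intro computable_intros computable_funpow[of "\<lambda>r x. strip_neg r"] assms;
      unfold strip_neg_def; intro computable_intros)

lemma decidable_decode_int_less [computable_intros]:
  assumes "computable f" "computable g" shows "decidable (\<lambda>x. decode_int (f x) < decode_int (g x))"
proof -
  have "decode_int m < decode_int n \<longleftrightarrow> pfst m + psnd n < pfst n + psnd m" for m n
    by (auto simp: decode_int_def)
  then show ?thesis by (simp only:) (intro computable_intros assms)
qed

lemma decidable_decode_int_eq [computable_intros]:
  assumes "computable f" "computable g" shows "decidable (\<lambda>x. decode_int (f x) = decode_int (g x))"
proof -
  have "decode_int m = decode_int n \<longleftrightarrow> pfst m + psnd n = pfst n + psnd m" for m n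
    by (auto simp: decode_int_def)
  then show ?thesis by (simp only:) (intro computable_intros assms)
qed

lemma decidable_decode_int_cong [computable_intros]:
  assumes "computable f" "computable g"
  shows "decidable (\<lambda>x. [decode_int (f x) = int (g x)] (mod int p))"
proof -
  have "[decode_int m = int a] (mod int p) \<longleftrightarrow> pfst m mod p = (a + psnd m) mod p" for m a
  proof -
    have "[decode_int m = int a] (mod int p) \<longleftrightarrow> [int (pfst m) = int (a + psnd m)] (mod int p)"
      by (simp add: decode_int_def cong_iff_dvd_diff algebra_simps)
    also have "\<dots> \<longleftrightarrow> [pfst m = a + psnd m] (mod p)" by (rule cong_int_iff)
    finally show ?thesis by (simp only: cong_def)
  qed
  then show ?thesis by (simp only:) (intro computable_intros assms)
qed

text \<open>Not uniform in \<open>\<phi>\<close>: the induction builds a separate algorithm for each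
  formula. This is enough for the interpreted atoms, which are fixed formulas.\<close>

lemma decidable_sat:
  assumes p: "p > 0" and "\<phi> \<in> Lp_min p" and "computable f"
  shows "decidable (\<lambda>x. sat p (env (f x)) \<phi>)"
  using assms(2,3)
proof (induction \<phi> arbitrary: f)
  case (7 \<phi>)
  show ?case
    unfolding sat_env_FEx[OF p 7(1) order_refl]
    by (intro computable_intros 7(2) 7(3) computable_comp[OF 7(3)])
next
  case (8 \<phi>)
  show ?case
    unfolding sat_env_FAll[OF p 8(1) order_refl]
    by (intro computable_intros 8(2) 8(3) computable_comp[OF 8(3)])
qed (simp_all flip: decode_int_eval_tm add: computable_intros)

text \<open>The value at \<open>c\<close> of a course-of-values recursion on \<open>c\<close> is a set of parameters \<open>e < E\<close>;
  the sets for all smaller arguments are passed on as a single binary expansion.\<close>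

primrec table :: "(nat \<Rightarrow> nat \<Rightarrow> nat \<Rightarrow> bool) \<Rightarrow> nat \<Rightarrow> nat \<Rightarrow> nat" where
  "table C E 0 = 0"
| "table C E (Suc k) =
     table C E k + (\<Sum>e<E. of_bool (C (table C E k) k e) * 2 ^ prod_encode (k, e))"

text \<open>Since \<open>prod_encode\<close> is injective, different rows occupy disjoint bit
  positions. Adding a row is therefore a union and leaves earlier entries intact.\<close>

lemma set_decode_table:
  "prod_encode (c, e) \<in> set_decode (table C E k) \<longleftrightarrow> c < k \<and> e < E \<and> C (table C E c) c e"
proof -
  define row where "row k = (\<lambda>e. prod_encode (k, e)) ` {e. e < E \<and> C (table C E k) k e}" for k
  have "table C E k = set_encode (\<Union>c<k. row c)"
  proof (induction k)
    case (Suc k)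
    have "set_encode (row k) = (\<Sum>e | e < E \<and> C (table C E k) k e. 2 ^ prod_encode (k, e))"
      unfolding set_encode_def row_def by (subst sum.reindex) (auto simp: inj_on_def)
    also have "\<dots> = (\<Sum>e<E. if C (table C E k) k e then 2 ^ prod_encode (k, e) else 0)"
      by (subst sum.inter_filter[symmetric]) (auto intro: sum.cong)
    also have "\<dots> = (\<Sum>e<E. of_bool (C (table C E k) k e) * 2 ^ prod_encode (k, e))"
      by (rule sum.cong) auto
    finally have "table C E (Suc k) = set_encode (\<Union>c<k. row c) + set_encode (row k)"
      by (simp add: Suc.IH)
    also have "\<dots> = set_encode ((\<Union>c<k. row c) \<union> row k)"
      unfolding set_encode_def by (rule sum.union_disjoint[symmetric]) (auto simp: row_def)
    finally show ?case by (simp add: lessThan_Suc Un_commute)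
  qed simp
  moreover have "finite (\<Union>c<k. row c)" by (auto simp: row_def)
  ultimately have "set_decode (table C E k) = (\<Union>c<k. row c)" by simp
  then show ?thesis by (auto simp: row_def)
qed

lemma computable_table:
  assumes C: "\<And>f g h. computable f \<Longrightarrow> computable g \<Longrightarrow> computable h \<Longrightarrow> decidable (\<lambda>x. C (f x) (g x) (h x))"
    and "computable f" "computable g"
  shows "computable (\<lambda>x. table C (f x) (g x))"
proof -
  have "rec_nat 0 (\<lambda>k r. r + (\<Sum>e<E. of_bool (C r k e) * 2 ^ prod_encode (k, e))) k = table C E k" for E k
    by (induction k) auto
  moreover have "computable
      (\<lambda>x. rec_nat 0 (\<lambda>k r. r + (\<Sum>e<f x. of_bool (C r k e) * 2 ^ prod_encode (k, e))) (g x))"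
    by (intro computable_intros C assms(2,3) computable_comp[OF assms(2)])
  ultimately show ?thesis by simp
qed

section \<open>Truth of coded formulas, with bounds for environments and radii\<close>

definition triple_code :: "nat \<Rightarrow> nat \<Rightarrow> nat \<Rightarrow> nat" where
  "triple_code a b c = prod_encode (a, prod_encode (b, prod_encode (c, 0)))"

lemma env_triple_code: "env (triple_code a b c) = triple (decode_int a) (decode_int b) (decode_int c)"
  by (simp add: triple_code_def env_prod_encode env_0 triple_def)

text \<open>If \<open>l\<close> codes a sum or product of two variables and \<open>r\<close> a
  variable, the projections are the three variable indices. In a \<open>basic\<close> formula sums
  and products occur only in this form, so the tags 3 and 4 of \<open>l\<close> identify these
  atoms.\<close>

definition atom_args :: "nat \<Rightarrow> nat \<Rightarrow> nat \<Rightarrow> nat" where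
  "atom_args l r e =
     triple_code (lookup e (psnd (pfst (psnd l)))) (lookup e (psnd (psnd (psnd l)))) (lookup e (psnd r))"

definition eval_less :: "nat \<Rightarrow> fm \<Rightarrow> fm \<Rightarrow> nat \<Rightarrow> nat \<Rightarrow> nat \<Rightarrow> bool" where
  "eval_less p \<sigma> \<pi> l r e =
     (if pfst l = 3 then sat p (env (atom_args l r e)) (less_fm p (+) \<sigma> 0 1 2)
      else if pfst l = 4 then sat p (env (atom_args l r e)) (less_fm p (*) \<pi> 0 1 2)
      else decode_int (eval_tm l e) < decode_int (eval_tm r e))"

definition eval_eq :: "nat \<Rightarrow> fm \<Rightarrow> fm \<Rightarrow> nat \<Rightarrow> nat \<Rightarrow> nat \<Rightarrow> bool" where
  "eval_eq p \<sigma> \<pi> l r e =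
     (if pfst l = 3 then sat p (env (atom_args l r e)) (eq_fm p (+) \<sigma> 0 1 2)
      else if pfst l = 4 then sat p (env (atom_args l r e)) (eq_fm p (*) \<pi> 0 1 2)
      else decode_int (eval_tm l e) = decode_int (eval_tm r e))"

text \<open>The search bound of \<open>sat_env_FEx\<close> with \<open>N = 4 ^ c * K\<close>, where
  \<open>c\<close> is the code of the quantified formula and hence larger than that of its
  body.\<close>

definition quant_bound :: "nat \<Rightarrow> nat \<Rightarrow> nat \<Rightarrow> nat \<Rightarrow> nat" where
  "quant_bound p K c e = Suc (prod_encode (e + (4 ^ c * K + p), e + (4 ^ c * K + p)))"

text \<open>
  The truth values of the proper subformulas are read off from \<open>s\<close>. The factor \<open>4 ^ c * K\<close> is a bound for
  the radius of the interpretation of a formula with code \<open>c\<close>; see \<open>radius_coarse_fm\<close>.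
\<close>

definition eval_fm :: "nat \<Rightarrow> fm \<Rightarrow> fm \<Rightarrow> nat \<Rightarrow> nat \<Rightarrow> nat \<Rightarrow> nat \<Rightarrow> bool" where
  "eval_fm p \<sigma> \<pi> K s c e =
     (if pfst c = 0 then eval_less p \<sigma> \<pi> (pfst (psnd c)) (psnd (psnd c)) e
      else if pfst c = 1 then eval_eq p \<sigma> \<pi> (pfst (psnd c)) (psnd (psnd c)) e
      else if pfst c = 2 then [decode_int (eval_tm (psnd (psnd c)) e) = int (pfst (psnd c))] (mod int p)
      else if pfst c = 3 then \<not> prod_encode (psnd c, e) \<in> set_decode s
      else if pfst c = 4 then
        prod_encode (pfst (psnd c), e) \<in> set_decode s \<and> prod_encode (psnd (psnd c), e) \<in> set_decode s
      else if pfst c = 5 then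
        prod_encode (pfst (psnd c), e) \<in> set_decode s \<or> prod_encode (psnd (psnd c), e) \<in> set_decode s
      else if pfst c = 6 then
        \<exists>m<quant_bound p K c e. prod_encode (psnd c, prod_encode (m, e)) \<in> set_decode s
      else \<forall>m<quant_bound p K c e. prod_encode (psnd c, prod_encode (m, e)) \<in> set_decode s)"

lemma eval_fm_simps:
  "eval_fm p \<sigma> \<pi> K s (prod_encode (0, prod_encode (l, r))) e \<longleftrightarrow> eval_less p \<sigma> \<pi> l r e"
  "eval_fm p \<sigma> \<pi> K s (prod_encode (1, prod_encode (l, r))) e \<longleftrightarrow> eval_eq p \<sigma> \<pi> l r e"
  "eval_fm p \<sigma> \<pi> K s (prod_encode (2, prod_encode (a, r))) e \<longleftrightarrow>
    [decode_int (eval_tm r e) = int a] (mod int p)"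
  "eval_fm p \<sigma> \<pi> K s (prod_encode (3, b)) e \<longleftrightarrow> prod_encode (b, e) \<notin> set_decode s"
  "eval_fm p \<sigma> \<pi> K s (prod_encode (4, prod_encode (b, b'))) e \<longleftrightarrow>
    prod_encode (b, e) \<in> set_decode s \<and> prod_encode (b', e) \<in> set_decode s"
  "eval_fm p \<sigma> \<pi> K s (prod_encode (5, prod_encode (b, b'))) e \<longleftrightarrow>
    prod_encode (b, e) \<in> set_decode s \<or> prod_encode (b', e) \<in> set_decode s"
  "eval_fm p \<sigma> \<pi> K s (prod_encode (6, b)) e \<longleftrightarrow>
    (\<exists>m<quant_bound p K (prod_encode (6, b)) e. prod_encode (b, prod_encode (m, e)) \<in> set_decode s)"
  "eval_fm p \<sigma> \<pi> K s (prod_encode (7, b)) e \<longleftrightarrow>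
    (\<forall>m<quant_bound p K (prod_encode (7, b)) e. prod_encode (b, prod_encode (m, e)) \<in> set_decode s)"
  by (simp_all add: eval_fm_def)

lemma decidable_eval_fm:
  assumes p: "p > 0" and \<sigma>: "\<sigma> \<in> Lp_min p" and \<pi>: "\<pi> \<in> Lp_min p"
    and fgh: "computable f" "computable g" "computable h"
  shows "decidable (\<lambda>x. eval_fm p \<sigma> \<pi> K (f x) (g x) (h x))"
  unfolding eval_fm_def eval_less_def eval_eq_def atom_args_def triple_code_def quant_bound_def
  by (intro computable_intros decidable_sat[OF p] eq_fm_Lp_min[OF p] less_fm_Lp_min[OF p] \<sigma> \<pi> fgh
      fgh[THEN computable_comp[rotated]] computable_comp[OF fgh(1)] computable_comp[OF fgh(2)] computable_comp[OF fgh(3)])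

text \<open>Bounds the codes of the environments that occur below \<open>j\<close> quantifiers.\<close>

primrec env_bound :: "nat \<Rightarrow> nat \<Rightarrow> nat \<Rightarrow> nat \<Rightarrow> nat" where
  "env_bound p K c 0 = 1"
| "env_bound p K c (Suc j) =
     (let X = env_bound p K c j + (4 ^ c * K + p) in Suc (prod_encode (prod_encode (X, X), X)))"

text \<open>The outer code \<open>c\<close> stands in for the code \<open>b\<close> of the
  quantified subformula, so one sequence of bounds serves all subformulas at the same depth.\<close>

lemma env_bound_Suc:
  assumes "e < env_bound p K c j" "K > 0" "b \<le> c" "m < quant_bound p K b e"
  shows "prod_encode (m, e) < env_bound p K c (Suc j)"
proof -
  define X where "X = env_bound p K c j + (4 ^ c * K + p)"
  have "(4::nat) ^ b \<le> 4 ^ c" using assms(3) by (intro power_increasing) auto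
  then have "4 ^ b * K \<le> 4 ^ c * K" by simp
  then have X: "e + (4 ^ b * K + p) \<le> X" "e \<le> X" using assms(1) unfolding X_def by linarith+
  then have "m \<le> prod_encode (X, X)"
    using assms(4) prod_encode_mono[OF X(1) X(1)] unfolding quant_bound_def by linarith
  then show ?thesis
    using prod_encode_mono[OF _ X(2)] by (simp add: X_def[symmetric] Let_def less_Suc_eq_le)
qed

lemma env_bound_mono: "i \<le> j \<Longrightarrow> env_bound p K c i \<le> env_bound p K c j"
proof (rule lift_Suc_mono_le[of "env_bound p K c"])
  fix n
  define X where "X = env_bound p K c n + (4 ^ c * K + p)"
  show "env_bound p K c n \<le> env_bound p K c (Suc n)"
    using add_le_prod_encode[of "prod_encode (X, X)" X] by (simp add: X_def[symmetric] Let_def) (simp add: X_def)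
qed

lemma computable_env_bound [computable_intros]:
  assumes "computable f" "computable g"
  shows "computable (\<lambda>x. env_bound p K (f x) (g x))"
proof -
  have "rec_nat 1 (\<lambda>j r. Suc (prod_encode (prod_encode (r + (4 ^ c * K + p), r + (4 ^ c * K + p)),
      r + (4 ^ c * K + p)))) n = env_bound p K c n" for c n
    by (induction n) (auto simp: Let_def)
  moreover have "computable (\<lambda>x. rec_nat 1 (\<lambda>j r. Suc (prod_encode (prod_encode
      (r + (4 ^ f x * K + p), r + (4 ^ f x * K + p)), r + (4 ^ f x * K + p)))) (g x))"
    by (intro computable_intros assms computable_comp[OF assms(1)])
  ultimately show ?thesis by simp
qed

text \<open>A quantifier takes \<open>n\<close> to \<open>3 * n + 2 * p + 1\<close>, at most four
  times the old bound because \<open>2 * p + 1 \<le> K\<close>, and it raises the code by at least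
  1. \<open>K\<close> dominates the interpreted atoms, and numerals in other atoms are bounded by
  the code.\<close>

lemma radius_coarse_fm:
  assumes K: "3 * (radius p \<sigma> + radius p \<pi> + 1) + 2 * p + 1 \<le> K"
  shows "radius p (coarse_fm p \<sigma> \<pi> \<psi>) \<le> 4 ^ code_fm \<psi> * K"
proof (induction \<psi>)
  have pow: "4 ^ a * K \<le> 4 ^ b * K" if "a \<le> b" for a b :: nat
    using that by (intro mult_right_mono power_increasing) auto
  have mono: "n \<le> 4 ^ b * K" if "n \<le> 4 ^ a * K" "a \<le> b" for n a b
    using that(1) pow[OF that(2)] by (rule order_trans)
  have quant: "3 * n + 2 * p + 1 \<le> 4 ^ b * K" if "n \<le> 4 ^ a * K" "a < b" for n a b
  proof -
    have "K \<le> 4 ^ a * K" using pow[of 0 a] by simp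
    with K have "2 * p + 1 \<le> 4 ^ a * K" by linarith
    with that(1) have "3 * n + 2 * p + 1 \<le> 4 ^ Suc a * K" by simp
    also have "\<dots> \<le> 4 ^ b * K" using that(2) by (intro pow) simp
    finally show ?thesis .
  qed
  have K_le: "K \<le> 4 ^ a * K" for a :: nat
    using pow[of 0 a] by simp
  have atom: "tm_const s + tm_const t + 1 \<le> 4 ^ prod_encode (k, prod_encode (code_tm s, code_tm t)) * K" for s t k
  proof -
    let ?c = "prod_encode (k, prod_encode (code_tm s, code_tm t))"
    have "tm_const s + tm_const t \<le> ?c"
      using tm_const_le_code[of s] tm_const_le_code[of t] add_le_prod_encode[of "code_tm s" "code_tm t"]
        add_le_prod_encode[of k "prod_encode (code_tm s, code_tm t)"] by linarith
    also have "?c < 4 ^ ?c" by (rule power_gt_expt) simp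
    also have "\<dots> \<le> 4 ^ ?c * K" using K by (cases K) auto
    finally show ?thesis by simp
  qed
  have eq: "radius p (eq_fm p f \<alpha> x y z) \<le> radius p \<alpha> + 1" for f \<alpha> x y z
    using radius_residues_fm[of p f x y z] by (simp add: eq_fm_def inst3_def)
  have less_fm: "radius p (less_fm p f \<alpha> x y z) \<le> 3 * (radius p \<alpha> + 1) + 2 * p + 1" for f \<alpha> x y z
    using eq[of f \<alpha> "Suc x" "Suc y" 0] by (simp add: less_fm_def)
  {
    case (Less s t)
    have "radius p (coarse_fm p \<sigma> \<pi> (Less s t)) \<le> tm_const s + tm_const t + 1 \<or>
        radius p (coarse_fm p \<sigma> \<pi> (Less s t)) \<le> K"
      by (auto split: tm.split intro!: order_trans[OF less_fm] order_trans[OF _ K])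
    then show ?case using atom[of s t 0] K_le by (auto intro: order_trans)
  next
    case (Eq s t)
    have "radius p (coarse_fm p \<sigma> \<pi> (Eq s t)) \<le> tm_const s + tm_const t + 1 \<or>
        radius p (coarse_fm p \<sigma> \<pi> (Eq s t)) \<le> K"
      by (auto split: tm.split intro!: order_trans[OF eq] order_trans[OF _ K])
    then show ?case using atom[of s t 1] K_le by (auto intro: order_trans)
  next
    case (FNot \<phi>)
    show ?case by (simp, intro mono[OF FNot.IH] le_prod_encode order_refl)
  next
    case (FAnd \<phi> \<psi>)
    show ?case by (simp, intro conjI mono[OF FAnd.IH(1)] mono[OF FAnd.IH(2)] le_prod_encode order_refl)
  next
    case (FOr \<phi> \<psi>)
    show ?case by (simp, intro conjI mono[OF FOr.IH(1)] mono[OF FOr.IH(2)] le_prod_encode order_refl)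
  next
    case (FEx \<phi>)
    show ?case using quant[OF FEx] prod_encode_less[of 6 "code_fm \<phi>"] by simp
  next
    case (FAll \<phi>)
    show ?case using quant[OF FAll] prod_encode_less[of 7 "code_fm \<phi>"] by simp
  next
    case (Rel a t)
    show ?case by simp
  }
qed

text \<open>Passing below a quantifier raises the depth \<open>j\<close> by 1 and lowers the code by
  at least 1, so \<open>code_fm \<psi> + j \<le> c\<close> is invariant. Hence \<open>j\<close>
  never exceeds \<open>c\<close>, and the single bound \<open>E\<close> covers every environment
  that is looked up. Subformulas have smaller codes, so their rows are already in the table.\<close>

lemma eval_fm_correct:
  assumes p: "p > 0" and \<sigma>: "\<sigma> \<in> Lp_min p" and \<pi>: "\<pi> \<in> Lp_min p"
    and K: "3 * (radius p \<sigma> + radius p \<pi> + 1) + 2 * p + 1 \<le> K"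
    and "\<psi> \<in> basic p" "code_fm \<psi> + j \<le> c" "e < env_bound p K c j"
  defines "C \<equiv> eval_fm p \<sigma> \<pi> K" and "E \<equiv> env_bound p K c c"
  shows "C (table C E (code_fm \<psi>)) (code_fm \<psi>) e \<longleftrightarrow> sat p (env e) (coarse_fm p \<sigma> \<pi> \<psi>)"
proof -
  have mem: "prod_encode (b, e') \<in> set_decode (table C E k) \<longleftrightarrow> C (table C E b) b e'"
    if "b < k" "b + i \<le> c" "e' < env_bound p K c i" for b k i e'
  proof -
    have "env_bound p K c i \<le> E" unfolding E_def using that(2) by (intro env_bound_mono) simp
    then show ?thesis using that by (simp add: set_decode_table)
  qed
  have K0: "K > 0" using K by simp
  have less: "k < prod_encode (t, k)" if "t > 0" for k t by (rule prod_encode_less[OF that])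
  have less2: "a < prod_encode (t, prod_encode (a, b))" "b < prod_encode (t, prod_encode (a, b))" if "t > 0" for a b t
    using add_le_prod_encode[of a b] less[OF that, of "prod_encode (a, b)"] by linarith+
  note fm = coarse_fm_Lp_min[OF p \<sigma> \<pi>]
  show ?thesis
    using assms(5-7)
  proof (induction \<psi> arbitrary: j e)
    case (1 s t)
    \<comment> \<open>A minimal term is neither a sum nor a product, so the evaluation takes the
      branch of ordinary terms.\<close>
    then have "pfst (code_tm s) \<noteq> 3" "pfst (code_tm s) \<noteq> 4" by (cases s; simp)+
    with 1 show ?case
      by (simp only: C_def eval_fm_simps code_fm.simps) (simp add: eval_less_def decode_int_eval_tm coarse_fm_min_tm del: coarse_fm.simps)
  next
    case (2 s t)
    then have "pfst (code_tm s) \<noteq> 3" "pfst (code_tm s) \<noteq> 4" by (cases s; simp)+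
    with 2 show ?case
      by (simp only: C_def eval_fm_simps code_fm.simps) (simp add: eval_eq_def decode_int_eval_tm coarse_fm_min_tm del: coarse_fm.simps)
  next
    case (3 a t)
    then show ?case by (simp add: C_def eval_fm_simps[simplified] decode_int_eval_tm)
  next
    case (4 x y z)
    show ?case
      by (simp add: C_def eval_fm_simps[simplified] eval_eq_def atom_args_def env_triple_code env_def[symmetric]
          sat_eq_fm[of p "env e" _ _ x y z])
  next
    case (5 x y z)
    show ?case
      by (simp add: C_def eval_fm_simps[simplified] eval_less_def atom_args_def env_triple_code env_def[symmetric]
          sat_less_fm[of p "env e" _ _ x y z])
  next
    case (6 x y z)
    show ?case
      by (simp add: C_def eval_fm_simps[simplified] eval_eq_def atom_args_def env_triple_code env_def[symmetric]
          sat_eq_fm[of p "env e" _ _ x y z])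
  next
    case (7 x y z)
    show ?case
      by (simp add: C_def eval_fm_simps[simplified] eval_less_def atom_args_def env_triple_code env_def[symmetric]
          sat_less_fm[of p "env e" _ _ x y z])
  next
    case (8 \<phi>)
    have b: "code_fm \<phi> < code_fm (FNot \<phi>)" by (simp add: less)
    with 8 have "code_fm \<phi> + j \<le> c" by linarith
    with 8 mem[OF b this] show ?case by (simp add: C_def eval_fm_simps[simplified])
  next
    case (9 \<phi> \<psi>)
    have b: "code_fm \<phi> < code_fm (FAnd \<phi> \<psi>)" "code_fm \<psi> < code_fm (FAnd \<phi> \<psi>)" by (simp_all add: less2)
    with 9 have "code_fm \<phi> + j \<le> c" "code_fm \<psi> + j \<le> c" by linarith+
    with 9 mem[OF b(1) this(1)] mem[OF b(2) this(2)] show ?case by (simp add: C_def eval_fm_simps[simplified])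
  next
    case (10 \<phi> \<psi>)
    have b: "code_fm \<phi> < code_fm (FOr \<phi> \<psi>)" "code_fm \<psi> < code_fm (FOr \<phi> \<psi>)" by (simp_all add: less2)
    with 10 have "code_fm \<phi> + j \<le> c" "code_fm \<psi> + j \<le> c" by linarith+
    with 10 mem[OF b(1) this(1)] mem[OF b(2) this(2)] show ?case by (simp add: C_def eval_fm_simps[simplified])
  next
    case (11 \<phi>)
    let ?k = "code_fm (FEx \<phi>)"
    have b: "code_fm \<phi> < ?k" by (simp add: less)
    with 11 have c: "code_fm \<phi> + Suc j \<le> c" by linarith
    have "radius p (coarse_fm p \<sigma> \<pi> \<phi>) \<le> 4 ^ ?k * K"
      by (rule order_trans[OF radius_coarse_fm[OF K]]) (use b in \<open>auto intro!: power_increasing\<close>)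
    note sat = sat_env_FEx[OF p fm[OF 11(1)] this]
    have body: "prod_encode (code_fm \<phi>, prod_encode (m, e)) \<in> set_decode (table C E ?k) \<longleftrightarrow>
        sat p (env (prod_encode (m, e))) (coarse_fm p \<sigma> \<pi> \<phi>)" if "m < quant_bound p K ?k e" for m
    proof -
      have e: "prod_encode (m, e) < env_bound p K c (Suc j)"
        using 11(3,4) that by (intro env_bound_Suc[OF _ K0 _ that]) auto
      show ?thesis using mem[OF b c e] 11(2)[OF c e] by blast
    qed
    have "C (table C E ?k) ?k e \<longleftrightarrow>
        (\<exists>m<quant_bound p K ?k e. prod_encode (code_fm \<phi>, prod_encode (m, e)) \<in> set_decode (table C E ?k))"
      by (simp add: C_def eval_fm_simps[simplified])
    also have "\<dots> \<longleftrightarrow> (\<exists>m<quant_bound p K ?k e. sat p (env (prod_encode (m, e))) (coarse_fm p \<sigma> \<pi> \<phi>))"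
      using body by blast
    also have "\<dots> \<longleftrightarrow> sat p (env e) (coarse_fm p \<sigma> \<pi> (FEx \<phi>))"
      unfolding coarse_fm.simps sat quant_bound_def ..
    finally show ?case .
  next
    case (12 \<phi>)
    let ?k = "code_fm (FAll \<phi>)"
    have b: "code_fm \<phi> < ?k" by (simp add: less)
    with 12 have c: "code_fm \<phi> + Suc j \<le> c" by linarith
    have "radius p (coarse_fm p \<sigma> \<pi> \<phi>) \<le> 4 ^ ?k * K"
      by (rule order_trans[OF radius_coarse_fm[OF K]]) (use b in \<open>auto intro!: power_increasing\<close>)
    note sat = sat_env_FAll[OF p fm[OF 12(1)] this]
    have body: "prod_encode (code_fm \<phi>, prod_encode (m, e)) \<in> set_decode (table C E ?k) \<longleftrightarrow>
        sat p (env (prod_encode (m, e))) (coarse_fm p \<sigma> \<pi> \<phi>)" if "m < quant_bound p K ?k e" for m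
    proof -
      have e: "prod_encode (m, e) < env_bound p K c (Suc j)"
        using 12(3,4) that by (intro env_bound_Suc[OF _ K0 _ that]) auto
      show ?thesis using mem[OF b c e] 12(2)[OF c e] by blast
    qed
    have "C (table C E ?k) ?k e \<longleftrightarrow>
        (\<forall>m<quant_bound p K ?k e. prod_encode (code_fm \<phi>, prod_encode (m, e)) \<in> set_decode (table C E ?k))"
      by (simp add: C_def eval_fm_simps[simplified])
    also have "\<dots> \<longleftrightarrow> (\<forall>m<quant_bound p K ?k e. sat p (env (prod_encode (m, e))) (coarse_fm p \<sigma> \<pi> \<phi>))"
      using body by blast
    also have "\<dots> \<longleftrightarrow> sat p (env e) (coarse_fm p \<sigma> \<pi> (FAll \<phi>))"
      unfolding coarse_fm.simps sat quant_bound_def ..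
    finally show ?case .
  qed
qed

section \<open>Dependence on finitely many variables and existential closure\<close>

lemma tm_val_cong: "(\<And>i. i \<in> tm_vars t \<Longrightarrow> e i = e' i) \<Longrightarrow> tm_val e t = tm_val e' t"
  by (induction t) auto

lemma tm_vars_le_code: "i \<in> tm_vars t \<Longrightarrow> i \<le> code_tm t"
  by (induction t) (auto intro: le_prod_encode)

text \<open>Pairing dominates its components, so the index of each free variable is at most the
  code. This gives a computable number of variables to quantify.\<close>

lemma sat_coarse_fm_cong:
  assumes "\<psi> \<in> basic p" "\<And>i. i \<le> code_fm \<psi> \<Longrightarrow> e i = e' i"
  shows "sat p e (coarse_fm p \<sigma> \<pi> \<psi>) \<longleftrightarrow> sat p e' (coarse_fm p \<sigma> \<pi> \<psi>)"
  using assms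
proof (induction \<psi> arbitrary: e e')
  have vars: "e i = e' i"
    if "\<And>i. i \<le> prod_encode (k, prod_encode (code_tm s, code_tm t)) \<Longrightarrow> e i = e' i"
      "i \<in> tm_vars s \<union> tm_vars t" for e e' :: "nat \<Rightarrow> int" and i k s t
    using that(2) by (intro that(1)) (auto dest: tm_vars_le_code intro: le_prod_encode)
  have quant: "(case_nat n e i :: int) = case_nat n e' i"
    if "\<And>i. i \<le> prod_encode (t, b) \<Longrightarrow> e i = e' i" "i \<le> b" for n :: int and e e' i t b
    using that(2) by (cases i) (auto intro!: that(1) intro: le_prod_encode)
  {
    case (1 s t)
    have "tm_val e s = tm_val e' s" "tm_val e t = tm_val e' t"
      by (rule tm_val_cong; use vars[of 0 s t e e'] 1(3) in simp)+
    with 1 show ?case by (simp add: coarse_fm_min_tm del: coarse_fm.simps)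
  next
    case (2 s t)
    have "tm_val e s = tm_val e' s" "tm_val e t = tm_val e' t"
      by (rule tm_val_cong; use vars[of 1 s t e e'] 2(3) in simp)+
    with 2 show ?case by (simp add: coarse_fm_min_tm del: coarse_fm.simps)
  next
    case (3 a t)
    have "tm_val e t = tm_val e' t"
      by (rule tm_val_cong, rule 3(3)) (auto dest: tm_vars_le_code intro: le_prod_encode)
    then show ?case by simp
  next
    case (4 x y z)
    have "e i = e' i" if "i \<in> {x, y, z}" for i
      using 4 that vars[of 1 "Add (Var x) (Var y)" "Var z" e e' i] by auto
    then show ?case by (simp add: sat_eq_fm[of p _ _ _ x y z])
  next
    case (5 x y z)
    have "e i = e' i" if "i \<in> {x, y, z}" for i
      using 5 that vars[of 0 "Add (Var x) (Var y)" "Var z" e e' i] by auto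
    then show ?case by (simp add: sat_less_fm[of p _ _ _ x y z])
  next
    case (6 x y z)
    have "e i = e' i" if "i \<in> {x, y, z}" for i
      using 6 that vars[of 1 "Mul (Var x) (Var y)" "Var z" e e' i] by auto
    then show ?case by (simp add: sat_eq_fm[of p _ _ _ x y z])
  next
    case (7 x y z)
    have "e i = e' i" if "i \<in> {x, y, z}" for i
      using 7 that vars[of 0 "Mul (Var x) (Var y)" "Var z" e e' i] by auto
    then show ?case by (simp add: sat_less_fm[of p _ _ _ x y z])
  next
    case (8 \<phi>)
    have "sat p e (coarse_fm p \<sigma> \<pi> \<phi>) \<longleftrightarrow> sat p e' (coarse_fm p \<sigma> \<pi> \<phi>)"
      by (rule 8(2)) (use 8(3) in \<open>auto intro: le_prod_encode\<close>)
    then show ?case by simp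
  next
    case (9 \<phi> \<psi>)
    have "sat p e (coarse_fm p \<sigma> \<pi> \<phi>) \<longleftrightarrow> sat p e' (coarse_fm p \<sigma> \<pi> \<phi>)"
      by (rule 9(3)) (use 9(5) in \<open>auto intro: le_prod_encode\<close>)
    moreover have "sat p e (coarse_fm p \<sigma> \<pi> \<psi>) \<longleftrightarrow> sat p e' (coarse_fm p \<sigma> \<pi> \<psi>)"
      by (rule 9(4)) (use 9(5) in \<open>auto intro: le_prod_encode\<close>)
    ultimately show ?case by simp
  next
    case (10 \<phi> \<psi>)
    have "sat p e (coarse_fm p \<sigma> \<pi> \<phi>) \<longleftrightarrow> sat p e' (coarse_fm p \<sigma> \<pi> \<phi>)"
      by (rule 10(3)) (use 10(5) in \<open>auto intro: le_prod_encode\<close>)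
    moreover have "sat p e (coarse_fm p \<sigma> \<pi> \<psi>) \<longleftrightarrow> sat p e' (coarse_fm p \<sigma> \<pi> \<psi>)"
      by (rule 10(4)) (use 10(5) in \<open>auto intro: le_prod_encode\<close>)
    ultimately show ?case by simp
  next
    case (11 \<phi>)
    have "sat p (case_nat n e) (coarse_fm p \<sigma> \<pi> \<phi>) \<longleftrightarrow> sat p (case_nat n e') (coarse_fm p \<sigma> \<pi> \<phi>)" for n
      by (rule 11(2)) (use quant[of 6 "code_fm \<phi>" e e'] 11(3) in auto)
    then show ?case by simp
  next
    case (12 \<phi>)
    have "sat p (case_nat n e) (coarse_fm p \<sigma> \<pi> \<phi>) \<longleftrightarrow> sat p (case_nat n e') (coarse_fm p \<sigma> \<pi> \<phi>)" for n
      by (rule 12(2)) (use quant[of 7 "code_fm \<phi>" e e'] 12(3) in auto)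
    then show ?case by simp
  }
qed

lemma sat_FEx_funpow:
  "sat p e ((FEx ^^ k) \<phi>) \<longleftrightarrow> (\<exists>e'. (\<forall>i. e' (i + k) = e i) \<and> sat p e' \<phi>)"
proof (induction k arbitrary: e)
  case 0
  have "(\<forall>i. e' i = e i) \<longleftrightarrow> e' = e" for e' by auto
  then show ?case by simp
next
  case (Suc k)
  have *: "(\<exists>n. \<forall>i. e' (i + k) = case_nat n e i) \<longleftrightarrow> (\<forall>i. e' (i + Suc k) = e i)" for e' :: "nat \<Rightarrow> int"
  proof
    assume "\<exists>n. \<forall>i. e' (i + k) = case_nat n e i"
    then obtain n where "\<And>i. e' (i + k) = case_nat n e i" by blast
    from this[of "Suc _"] show "\<forall>i. e' (i + Suc k) = e i" by simp
  next
    assume e: "\<forall>i. e' (i + Suc k) = e i"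
    have "e' (i + k) = case_nat (e' k) e i" for i
      using e by (cases i) auto
    then show "\<exists>n. \<forall>i. e' (i + k) = case_nat n e i" by blast
  qed
  have "sat p e ((FEx ^^ Suc k) \<phi>) \<longleftrightarrow> (\<exists>n e'. (\<forall>i. e' (i + k) = case_nat n e i) \<and> sat p e' \<phi>)"
    by (simp add: Suc.IH)
  also have "\<dots> \<longleftrightarrow> (\<exists>e'. (\<forall>i. e' (i + Suc k) = e i) \<and> sat p e' \<phi>)"
    unfolding *[symmetric] by blast
  finally show ?case .
qed

text \<open>The prefix binds the indices 0 to \<open>code_fm \<psi>\<close>, one more than the code
  in number. A solution set to 0 beyond them is still a solution, and is one of the environments
  over which the prefix ranges.\<close>

lemma satisfiable_iff_FEx_funpow:
  assumes "\<psi> \<in> basic p"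
  shows "(\<exists>e. sat p e (coarse_fm p \<sigma> \<pi> \<psi>)) \<longleftrightarrow>
    sat p (\<lambda>_. 0) (coarse_fm p \<sigma> \<pi> ((FEx ^^ Suc (code_fm \<psi>)) \<psi>))"
proof -
  have fm: "coarse_fm p \<sigma> \<pi> ((FEx ^^ k) \<psi>) = (FEx ^^ k) (coarse_fm p \<sigma> \<pi> \<psi>)" for k
    by (induction k) auto
  show ?thesis unfolding fm sat_FEx_funpow
  proof
    assume "\<exists>e. sat p e (coarse_fm p \<sigma> \<pi> \<psi>)"
    then obtain e where e: "sat p e (coarse_fm p \<sigma> \<pi> \<psi>)" ..
    define e' where "e' = (\<lambda>i. if i \<le> code_fm \<psi> then e i else 0)"
    have "sat p e (coarse_fm p \<sigma> \<pi> \<psi>) \<longleftrightarrow> sat p e' (coarse_fm p \<sigma> \<pi> \<psi>)"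
      by (rule sat_coarse_fm_cong[OF assms]) (simp add: e'_def)
    with e show "\<exists>e'. (\<forall>i. e' (i + Suc (code_fm \<psi>)) = 0) \<and> sat p e' (coarse_fm p \<sigma> \<pi> \<psi>)"
      by (intro exI[of _ e']) (simp add: e'_def)
  qed blast
qed

theorem theorem3p1:
  fixes p :: nat and \<sigma> \<pi> :: fm and tr :: "fm \<Rightarrow> fm"
  assumes "p \<ge> 2"
    and "approx_sum p \<sigma>"
    and "approx_prod p \<pi>"
    and "translation p tr"
  shows "decidable_on (Lp p) (\<lambda>\<phi>. coarse p \<sigma> \<pi> tr \<phi> = lind_bot p)"
proof -
  have p: "p > 0" and \<sigma>: "\<sigma> \<in> Lp_min p" and \<pi>: "\<pi> \<in> Lp_min p"
    using assms by (auto simp: approx_sum_def approx_prod_def)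
  obtain f where f: "recursive 1 f" "\<And>\<phi>. \<phi> \<in> Lp p \<Longrightarrow> f [code_fm \<phi>] = code_fm (tr \<phi>)"
    using assms(4) unfolding translation_def computable_on_def by blast
  have basic: "tr \<phi> \<in> basic p" if "\<phi> \<in> Lp p" for \<phi>
    using assms(4) that unfolding translation_def by blast
  \<comment> \<open>\<open>K\<close> depends only on \<open>p\<close>, \<open>\<sigma>\<close> and
    \<open>\<pi>\<close>, so it is a constant of the algorithm.\<close>
  define K where "K = 3 * (radius p \<sigma> + radius p \<pi> + 1) + 2 * p + 1"
  define C where "C = eval_fm p \<sigma> \<pi> K"
  \<comment> \<open>The existential prefix is added on codes; 6 is the tag of
    \<open>FEx\<close>.\<close>
  define close where "close c = ((\<lambda>r. prod_encode (6, r)) ^^ Suc c) c" for c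
  \<comment> \<open>Bottom means unsolvable, hence the negation; the final 0 codes the zero
    environment.\<close>
  define P where "P c \<longleftrightarrow> \<not> C (table C (env_bound p K (close c) (close c)) (close c)) (close c) 0" for c
  have close: "close (code_fm \<psi>) = code_fm ((FEx ^^ Suc (code_fm \<psi>)) \<psi>)" for \<psi>
  proof -
    have "((\<lambda>r. prod_encode (6, r)) ^^ k) (code_fm \<psi>) = code_fm ((FEx ^^ k) \<psi>)" for k
      by (induction k) auto
    then show ?thesis by (simp only: close_def)
  qed
  have P: "P (code_fm (tr \<phi>)) \<longleftrightarrow> coarse p \<sigma> \<pi> tr \<phi> = lind_bot p" if "\<phi> \<in> Lp p" for \<phi>
  proof -
    let ?\<psi> = "tr \<phi>" and ?\<chi> = "(FEx ^^ Suc (code_fm (tr \<phi>))) (tr \<phi>)"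
    note \<psi> = basic[OF that]
    have "(FEx ^^ k) ?\<psi> \<in> basic p" for k
      by (induction k) (auto intro: \<psi> basic.intros)
    then have "P (code_fm ?\<psi>) \<longleftrightarrow> \<not> sat p (env 0) (coarse_fm p \<sigma> \<pi> ?\<chi>)"
      unfolding P_def close C_def
      \<comment> \<open>At the root no quantifier has been passed, so \<open>j = 0\<close>, and the
        environment code 0 lies below the initial value 1 of \<open>env_bound\<close>.\<close>
      by (subst eval_fm_correct[OF p \<sigma> \<pi>, where j = 0]) (auto simp: K_def simp del: funpow.simps)
    also have "\<dots> \<longleftrightarrow> \<not> (\<exists>e. sat p e (coarse_fm p \<sigma> \<pi> ?\<psi>))"
      unfolding env_0 satisfiable_iff_FEx_funpow[OF \<psi>] ..
    also have "\<dots> \<longleftrightarrow> cls p (coarse_fm p \<sigma> \<pi> ?\<psi>) = lind_bot p"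
      using coarse_fm_Lp_min[OF p \<sigma> \<pi> \<psi>] Lp_min_subset_Lp by (intro cls_eq_lind_bot_iff[symmetric]) blast
    finally show ?thesis
      unfolding coarse_def coarse_basic_cls[OF p \<sigma> \<pi> \<psi>] .
  qed
  have cf: "computable (\<lambda>x. f [x])"
    unfolding computable_iff using f(1) by blast
  have cc: "computable close"
    unfolding close_def[abs_def] by (intro computable_intros computable_funpow[of "\<lambda>r x. prod_encode (6, r)"])
  have C: "decidable (\<lambda>x. C (f x) (g x) (h x))" if "computable f" "computable g" "computable h" for f g h
    unfolding C_def by (rule decidable_eval_fm[OF p \<sigma> \<pi> that])
  have "computable (\<lambda>x. of_bool (P (f [x])))"
    unfolding P_def
    by (intro computable_intros C computable_table[of C, OF C] computable_comp[OF cc cf])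
  then obtain g where "recursive 1 g" "\<And>x. g [x] = of_bool (P (f [x]))"
    unfolding computable_iff by blast
  then show ?thesis
    unfolding decidable_on_def using f(2) P by (intro exI[of _ g]) auto
qed

end
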